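(* Fix a family of query ranges. Suppose that for every set of $n$ colored points there is a data structure with $P(n)$ (expected) preprocessing time and $S(n)$ space that decides whether the number of distinct colors in a query range is exactly $1$ in $Q_1(n)$ time, and that moreover decides whether the query range is empty and, if not, reports one point in it, in $Q_0(n)$ time. Assume $P(n)/n$ and $S(n)/n$ are nondecreasing. Then there is a randomized Las Vegas data structure with $O(P(n)\log n)$ expected preprocessing time and $O(S(n)\log n)$ space that reports all $k$ distinct colors of the points in a query range in $O(k(Q_0(n)+Q_1(n)))$ expected time.
   Context: Colored range reporting: given $n$ points each with a color, report the set of distinct colors of the points inside a query range. A Las Vegas data structure always answers correctly; its running time is random. Expected query time is with respect to the random choices of the data structure, for a query range fixed independently of these random choices (oblivious adversary).
   Formalization: The query times Q_0(n) and Q_1(n) are additionally assumed nondecreasing (the claim fails if they may be small only at isolated n), and for k = 0 the query bound is read as O(Q_0(n)+Q_1(n)), since O(0) time is impossible. *)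

theory Defs
  imports "HOL-Probability.Probability" "HOL-Library.Landau_Symbols"
begin

text \<open>
  The model of computation is a randomized word RAM with unit-cost instructions and
  word size \<open>w\<close>. Programs are finite pieces of syntax that do not depend on \<open>w\<close> or on the input.
  Besides words, a memory cell may hold an atom (a point, a query range, a coordinate, ...), which
  programs can inspect only through \<open>prim\<close>, an arbitrary repertoire of additional
  unit-cost operations (comparison of coordinates, bitwise operations, ...), or a reference to an
  immutable array. What preprocessing leaves behind is such an immutable value.
\<close>

datatype 'a scalar = Word nat | Atom 'a

datatype 'a val = Scalar "'a scalar" | Arr "'a val list"

text \<open>Sharing is disregarded, so this is an upper bound for the number of words occupied.\<close>

primrec vsize :: "'a val \<Rightarrow> nat" where
  "vsize (Scalar s) = 1"
| "vsize (Arr vs) = 1 + sum_list (map vsize vs)"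

datatype arith = Add | Sub | Mul | Div | Less

text \<open>Operands are register numbers, except for the literal in \<open>Const\<close>.\<close>

datatype 'o com =
    Const nat nat
  | Move nat nat
  | Arith nat arith nat nat
  | Prim nat 'o "nat list"
  | Load nat nat
  | Store nat nat
  | Freeze nat nat nat
  | Length nat nat
  | Index nat nat nat
  | Rand nat nat
  | Call nat "'o com" "nat list"
  | Seq "'o com" "'o com"
  | If nat "'o com" "'o com"
  | While nat "'o com"

type_synonym 'a state = "(nat \<Rightarrow> 'a val) \<times> (nat \<Rightarrow> 'a val)"  \<comment> \<open>registers, memory\<close>

abbreviation zero_val :: "'a val" where
  "zero_val \<equiv> Scalar (Word 0)"

text \<open>Ill-typed operands are read as 0, so that every instruction is total.\<close>

fun scalar_of :: "'a val \<Rightarrow> 'a scalar" where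
  "scalar_of (Scalar s) = s"
| "scalar_of (Arr vs) = Word 0"

fun word_of :: "'a val \<Rightarrow> nat" where
  "word_of (Scalar (Word n)) = n"
| "word_of _ = 0"

fun elems_of :: "'a val \<Rightarrow> 'a val list" where
  "elems_of (Arr vs) = vs"
| "elems_of (Scalar s) = []"

fun wrap :: "nat \<Rightarrow> 'a scalar \<Rightarrow> 'a scalar" where
  "wrap w (Word n) = Word (n mod 2 ^ w)"
| "wrap w (Atom a) = Atom a"

abbreviation word :: "nat \<Rightarrow> nat \<Rightarrow> 'a val" where
  "word w n \<equiv> Scalar (wrap w (Word n))"

fun arith_op :: "nat \<Rightarrow> arith \<Rightarrow> nat \<Rightarrow> nat \<Rightarrow> nat" where
  "arith_op w Add x y = x + y"
| "arith_op w Sub x y = x + (2 ^ w - y)"  \<comment> \<open>subtraction modulo \<open>2 ^ w\<close>, after wrapping\<close>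
| "arith_op w Mul x y = x * y"
| "arith_op w Div x y = x div y"
| "arith_op w Less x y = of_bool (x < y)"

text \<open>
  The semantics of a program is a subprobability distribution over pairs of result and
  running time; the missing mass is the probability of divergence.
\<close>

partial_function (spmf) while_loop ::
  "('s \<Rightarrow> bool) \<Rightarrow> ('s \<Rightarrow> ('s \<times> nat) spmf) \<Rightarrow> 's \<Rightarrow> ('s \<times> nat) spmf" where
  "while_loop b body s =
     (if b s then
        bind_spmf (body s) (\<lambda>(s1, t1).
        bind_spmf (while_loop b body s1) (\<lambda>(s2, t2).
        return_spmf (s2, Suc (t1 + t2))))
      else return_spmf (s, 1))"

text \<open>
  \<open>Call\<close> runs a subprogram on registers and memory of its own, zero-initialized apart from the
  arguments in registers 0, 1, ...; the result is what the subprogram leaves in register 0.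
  \<open>Freeze r i l\<close> copies a memory segment into a new immutable array, at a cost linear in its length.
\<close>

definition init_state :: "'a val list \<Rightarrow> 'a state" where
  "init_state args = (\<lambda>i. if i < length args then args ! i else zero_val, \<lambda>_. zero_val)"

primrec exec ::
  "nat \<Rightarrow> (nat \<Rightarrow> 'o \<Rightarrow> 'a scalar list \<Rightarrow> 'a scalar) \<Rightarrow> 'o com \<Rightarrow> 'a state \<Rightarrow> ('a state \<times> nat) spmf"
where
  "exec w prim (Const r n) = (\<lambda>(R, M). return_spmf ((R(r := word w n), M), 1))"
| "exec w prim (Move r i) = (\<lambda>(R, M). return_spmf ((R(r := R i), M), 1))"
| "exec w prim (Arith r f i j) = (\<lambda>(R, M).
     return_spmf ((R(r := word w (arith_op w f (word_of (R i)) (word_of (R j)))), M), 1))"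
| "exec w prim (Prim r f is) = (\<lambda>(R, M).
     return_spmf ((R(r := Scalar (wrap w (prim w f (map (\<lambda>i. scalar_of (R i)) is)))), M), 1))"
| "exec w prim (Load r i) = (\<lambda>(R, M). return_spmf ((R(r := M (word_of (R i))), M), 1))"
| "exec w prim (Store i j) = (\<lambda>(R, M). return_spmf ((R, M(word_of (R i) := R j)), 1))"
| "exec w prim (Freeze r i j) = (\<lambda>(R, M). let l = word_of (R j) in
     return_spmf ((R(r := Arr (map (\<lambda>k. M ((word_of (R i) + k) mod 2 ^ w)) [0..<l])), M), Suc l))"
| "exec w prim (Length r i) = (\<lambda>(R, M).
     return_spmf ((R(r := word w (length (elems_of (R i)))), M), 1))"
| "exec w prim (Index r i j) = (\<lambda>(R, M). let vs = elems_of (R i); k = word_of (R j) in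
     return_spmf ((R(r := (if k < length vs then vs ! k else zero_val)), M), 1))"
| "exec w prim (Rand r i) = (\<lambda>(R, M). let m = word_of (R i) in
     map_spmf (\<lambda>x. ((R(r := word w x), M), 1)) (spmf_of_set (if m = 0 then {0} else {0..<m})))"
| "exec w prim (Call r c is) = (\<lambda>(R, M).
     map_spmf (\<lambda>((R', M'), t). ((R(r := R' 0), M), Suc t)) (exec w prim c (init_state (map R is))))"
| "exec w prim (Seq c1 c2) = (\<lambda>s.
     bind_spmf (exec w prim c1 s) (\<lambda>(s1, t1).
     bind_spmf (exec w prim c2 s1) (\<lambda>(s2, t2).
     return_spmf (s2, t1 + t2))))"
| "exec w prim (If i c1 c2) = (\<lambda>s.
     map_spmf (\<lambda>(s1, t). (s1, Suc t))
       (if fst s i \<noteq> zero_val then exec w prim c1 s else exec w prim c2 s))"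
| "exec w prim (While i c) = while_loop (\<lambda>s. fst s i \<noteq> zero_val) (exec w prim c)"

definition run ::
  "nat \<Rightarrow> (nat \<Rightarrow> 'o \<Rightarrow> 'a scalar list \<Rightarrow> 'a scalar) \<Rightarrow> 'o com \<Rightarrow> 'a val list \<Rightarrow> ('a val \<times> nat) spmf"
where
  "run w prim c args = map_spmf (\<lambda>((R, M), t). (R 0, t)) (exec w prim c (init_state args))"

definition expected_time :: "('b \<times> nat) spmf \<Rightarrow> ennreal" where
  "expected_time p =
     (if lossless_spmf p then \<integral>\<^sup>+ x. of_nat (snd x) \<partial>measure_spmf p else \<top>)"

definition terminates_within :: "('b \<times> nat) spmf \<Rightarrow> real \<Rightarrow> bool" where
  "terminates_within p T \<longleftrightarrow> lossless_spmf p \<and> (\<forall>(v, t) \<in> set_spmf p. real t \<le> T)"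

definition returns :: "('b \<times> nat) spmf \<Rightarrow> ('b \<Rightarrow> bool) \<Rightarrow> bool" where
  "returns p Post \<longleftrightarrow> (\<forall>(v, t) \<in> set_spmf p. Post v)"

text \<open>
  A colored point is a pair of a point and a color, colors being identifiers that fit into a word.
\<close>

definition point_val :: "'a \<times> nat \<Rightarrow> 'a val" where
  "point_val x = Arr [Scalar (Atom (fst x)), Scalar (Word (snd x))]"

definition points_in :: "('a \<times> nat) set \<Rightarrow> 'a set \<Rightarrow> ('a \<times> nat) set" where
  "points_in X r = {x \<in> X. fst x \<in> r}"

definition colors_in :: "('a \<times> nat) set \<Rightarrow> 'a set \<Rightarrow> nat set" where
  "colors_in X r = snd ` points_in X r"

text \<open>
  The list \<open>xs\<close> enumerates (in arbitrary order) a set of colored points, with points taken from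
  the universe \<open>U w\<close>. The inequality says \<open>w \<ge> c * log 2 (n + 2)\<close>: the word size is at least a
  suitable constant times the logarithm of the number \<open>n\<close> of points.
\<close>

definition admissible :: "(nat \<Rightarrow> 'a set) \<Rightarrow> nat \<Rightarrow> nat \<Rightarrow> ('a \<times> nat) list \<Rightarrow> bool" where
  "admissible U c w xs \<longleftrightarrow>
     distinct xs \<and> set xs \<subseteq> U w \<times> {..<2 ^ w} \<and> (length xs + 2) ^ c \<le> 2 ^ w"

text \<open>
  The query ranges are the sets \<open>rng q\<close> for \<open>q \<in> V w\<close>. The universes may depend on the
  word size, as they do when coordinates are words.
\<close>

definition uniqueness_structure ::
  "(nat \<Rightarrow> 'a set) \<Rightarrow> (nat \<Rightarrow> 'a set) \<Rightarrow> ('a \<Rightarrow> 'a set) \<Rightarrow>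
   (nat \<Rightarrow> 'o \<Rightarrow> 'a scalar list \<Rightarrow> 'a scalar) \<Rightarrow>
   (nat \<Rightarrow> real) \<Rightarrow> (nat \<Rightarrow> real) \<Rightarrow> (nat \<Rightarrow> real) \<Rightarrow> (nat \<Rightarrow> real) \<Rightarrow> bool"
where
  "uniqueness_structure U V rng prim P S Q0 Q1 \<longleftrightarrow>
     (\<exists>c (build :: 'o com) (unique :: 'o com) (empty :: 'o com).
        \<forall>w xs. admissible U c w xs \<longrightarrow>
          (let n = length xs; X = set xs; D = run w prim build [Arr (map point_val xs)] in
             expected_time D \<le> ennreal (P n) \<and>
             returns D (\<lambda>d. real (vsize d) \<le> S n \<and>
               (\<forall>q \<in> V w.
                  let A1 = run w prim unique [d, Scalar (Atom q)];
                      A0 = run w prim empty [d, Scalar (Atom q)]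
                  in terminates_within A1 (Q1 n) \<and>
                     returns A1 (\<lambda>v. v = Scalar (Word (of_bool
                       (card (colors_in X (rng q)) = 1)))) \<and>
                     terminates_within A0 (Q0 n) \<and>
                     returns A0 (\<lambda>v. if points_in X (rng q) = {} then v = zero_val
                       else v \<in> point_val ` points_in X (rng q))))))"

text \<open>
  In the bound on the query time, \<open>q\<close> is fixed before the random choices are made, and the
  expectation is over the random choices of both preprocessing and query.
\<close>

definition color_reporting_structure ::
  "(nat \<Rightarrow> 'a set) \<Rightarrow> (nat \<Rightarrow> 'a set) \<Rightarrow> ('a \<Rightarrow> 'a set) \<Rightarrow>
   (nat \<Rightarrow> 'o \<Rightarrow> 'a scalar list \<Rightarrow> 'a scalar) \<Rightarrow>
   (nat \<Rightarrow> real) \<Rightarrow> (nat \<Rightarrow> real) \<Rightarrow> (nat \<Rightarrow> nat \<Rightarrow> real) \<Rightarrow> bool"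
where
  "color_reporting_structure U V rng prim P S Q \<longleftrightarrow>
     (\<exists>c (build :: 'o com) (report :: 'o com).
        \<forall>w xs. admissible U c w xs \<longrightarrow>
          (let n = length xs; X = set xs; D = run w prim build [Arr (map point_val xs)] in
             expected_time D \<le> ennreal (P n) \<and>
             returns D (\<lambda>d. real (vsize d) \<le> S n \<and>
               (\<forall>q \<in> V w. returns (run w prim report [d, Scalar (Atom q)])
                  (\<lambda>v. \<exists>cs. v = Arr (map (\<lambda>a. Scalar (Word a)) cs) \<and> distinct cs \<and>
                          set cs = colors_in X (rng q)))) \<and>
             (\<forall>q \<in> V w.
                expected_time (bind_spmf D (\<lambda>(d, t). run w prim report [d, Scalar (Atom q)]))
                  \<le> ennreal (Q n (card (colors_in X (rng q)))))))"

end

theory Submission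
  imports Defs
begin

text \<open>
  Number the distinct colors, choose a random odd \<open>a\<close>, and give the color with number \<open>y\<close> the rank
  \<open>a * y mod N\<close>, where \<open>N\<close> is a power of two with \<open>n \<le> N\<close>. This is a bijection on residues, and
  multiply-shift hashing shows that the ranks of two different colors agree in their \<open>i\<close> leading
  bits with probability at most \<open>2 / 2 ^ i\<close>. Build the complete binary tree over the ranks and store
  with every node a uniqueness structure for the points whose colors lie below it. A query descends
  only from nodes below which the query range contains at least two colors. At depth \<open>i\<close> there are at most
  \<open>min (2 ^ i) (2 * k ^ 2 / 2 ^ i)\<close> of them in expectation, hence \<open>O(k)\<close> in total. Each point is
  stored in \<open>log N + 1\<close> nodes, and \<open>P n / n\<close> and \<open>S n / n\<close> are monotone, which gives the
  logarithmic overhead in preprocessing time and space.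
\<close>

section \<open>Expected running time of programs\<close>

text \<open>The uniqueness test says only whether there is one color, so a query must separate the
  colors until each node sees at most one; the color itself is read off the point returned by the
  emptiness probe. Injective ranks leave at most one color per leaf, so every answer is correct and
  chance affects time only. One random word suffices because only collisions of pairs are estimated:
  they beat the trivial bound \<open>2 ^ i\<close> from the depth on where \<open>2 ^ i\<close> is
  about \<open>k\<close>, and both sides of this crossover sum geometrically. The given builders may
  be randomized too, in an unknown way. The query cost is therefore bounded by a function of the
  multiplier alone, whatever the builders do, and averaged over the multiplier, which is drawn after
  the numbering is fixed. No sign or size of the given bounds is assumed: that they are at least 1,
  and \<open>P n\<close> and \<open>S n\<close> at least \<open>n\<close>, follows from the given
  programs on suitable sublists and from monotonicity. Empty nodes cost \<open>P 0\<close> and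
  \<open>S 0\<close>, which enter the constants. An empty query range still costs a visit to the
  root, hence \<open>max 1 k\<close>.\<close>

lemma nn_integral_bind_spmf:
  "(\<integral>\<^sup>+ x. f x \<partial>measure_spmf (bind_spmf p k)) =
   (\<integral>\<^sup>+ y. (\<integral>\<^sup>+ x. f x \<partial>measure_spmf (k y)) \<partial>measure_spmf p)"
  unfolding measure_spmf_bind
  by (subst nn_integral_bind[where B = "count_space UNIV"])
     (auto simp: space_measure_spmf o_def space_subprob_algebra intro!: measurable_measure_spmf)

text \<open>A Hoare triple with expected cost: \<open>Post\<close> holds for every possible result,
  while \<open>T\<close> bounds the time only on average. Finiteness of \<open>ennreal T\<close>
  entails almost sure termination. Since \<open>ennreal\<close> maps negative reals to 0,
  \<open>0 \<le> T\<close> is demanded so that budgets add and subtract faithfully.\<close>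

definition runs_in :: "('b \<times> nat) spmf \<Rightarrow> real \<Rightarrow> ('b \<Rightarrow> bool) \<Rightarrow> bool" where
  "runs_in p T Post \<longleftrightarrow> 0 \<le> T \<and> expected_time p \<le> ennreal T \<and> returns p Post"

lemma runs_in_lossless: "runs_in p T Q \<Longrightarrow> lossless_spmf p"
  unfolding runs_in_def expected_time_def
  by (metis ennreal_less_top leD)

lemma runs_in_iff:
  "runs_in p T Q \<longleftrightarrow> 0 \<le> T \<and> lossless_spmf p \<and> (\<forall>(v, t) \<in> set_spmf p. Q v) \<and>
     (\<integral>\<^sup>+ x. of_nat (snd x) \<partial>measure_spmf p) \<le> ennreal T"
proof -
  have "\<not> \<top> \<le> ennreal T"
    by (metis ennreal_less_top leD)
  then show ?thesis by (auto simp: runs_in_def expected_time_def returns_def)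
qed

lemma runs_in_return [simp]:
  "runs_in (return_spmf (v, t)) T Q \<longleftrightarrow> real t \<le> T \<and> Q v"
  by (auto simp: runs_in_iff measure_spmf_return_spmf nn_integral_return
      ennreal_of_nat_eq_real_of_nat intro: order_trans[OF of_nat_0_le_iff])

lemma runs_in_weaken:
  "runs_in p T Q \<Longrightarrow> T \<le> T' \<Longrightarrow> (\<And>v. Q v \<Longrightarrow> Q' v) \<Longrightarrow> runs_in p T' Q'"
  by (fastforce simp: runs_in_iff intro: order_trans ennreal_leI)

lemma nn_integral_spmf_le:
  assumes "\<And>x. x \<in> set_spmf p \<Longrightarrow> f x \<le> B"
  shows "(\<integral>\<^sup>+ x. f x \<partial>measure_spmf p) \<le> B"
proof -
  have "(\<integral>\<^sup>+ x. f x \<partial>measure_spmf p) \<le> (\<integral>\<^sup>+ x. B \<partial>measure_spmf p)"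
    using assms by (intro nn_integral_mono_AE) (simp add: AE_measure_spmf_iff)
  also have "\<dots> \<le> B * 1"
    by (simp add: measure_spmf.subprob_emeasure_le_1 mult_left_mono del: mult_1_right)
  finally show ?thesis by simp
qed

lemma set_spmf_nonempty: "lossless_spmf p \<Longrightarrow> set_spmf p \<noteq> {}"
  using measure_spmf_zero_iff[of p UNIV] by (auto simp: lossless_spmf_def weight_spmf_def)

lemma runs_in_set: "runs_in p T Q \<Longrightarrow> y \<in> set_spmf p \<Longrightarrow> Q (fst y)"
  by (auto simp: runs_in_iff)

text \<open>The bound \<open>T'\<close> holds from every state satisfying \<open>A\<close>, so
  expected times add although the second run depends on the outcome of the first.\<close>

lemma runs_in_bind:
  assumes p: "runs_in p T A" and k: "\<And>s. A s \<Longrightarrow> runs_in (k s) T' B"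
  shows "runs_in (bind_spmf p (\<lambda>(s1, t1). bind_spmf (k s1) (\<lambda>(s2, t2). return_spmf (s2, t1 + t2))))
     (T + T') B" (is "runs_in ?r _ _")
proof -
  \<comment> \<open>Nonnegativity of \<open>T'\<close> is known only through some run of
    \<open>k\<close>; losslessness of \<open>p\<close> provides a state to start it from.\<close>
  obtain s where "A s"
  proof -
    have "set_spmf p \<noteq> {}" by (rule set_spmf_nonempty[OF runs_in_lossless[OF p]])
    with p that show ?thesis by (fastforce simp: runs_in_iff)
  qed
  with k have T': "0 \<le> T'" by (auto simp: runs_in_iff)
  have T: "0 \<le> T" using p by (simp add: runs_in_iff)
  have "(\<integral>\<^sup>+ x. of_nat (snd x) \<partial>measure_spmf ?r) =
    (\<integral>\<^sup>+ (s1, t1). (\<integral>\<^sup>+ (s2, t2). of_nat t1 + of_nat t2 \<partial>measure_spmf (k s1)) \<partial>measure_spmf p)"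
    by (simp add: nn_integral_bind_spmf case_prod_unfold measure_spmf_return_spmf nn_integral_return)
  also have "\<dots> \<le> (\<integral>\<^sup>+ (s1, t1). of_nat t1 + ennreal T' \<partial>measure_spmf p)"
  proof (intro nn_integral_mono_AE, simp add: AE_measure_spmf_iff, safe)
    fix s1 t1 assume "(s1, t1) \<in> set_spmf p"
    with p have "A s1" by (auto simp: runs_in_iff)
    then have r: "runs_in (k s1) T' B" by (rule k)
    have "(\<integral>\<^sup>+ (s2, t2). of_nat t1 + of_nat t2 \<partial>measure_spmf (k s1)) =
       (\<integral>\<^sup>+ x. of_nat t1 \<partial>measure_spmf (k s1)) + (\<integral>\<^sup>+ x. of_nat (snd x) \<partial>measure_spmf (k s1))"
      by (subst nn_integral_add[symmetric]) (auto simp: case_prod_unfold)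
    also have "\<dots> \<le> of_nat t1 * 1 + ennreal T'"
      using r by (intro add_mono)
        (auto simp: runs_in_iff measure_spmf.subprob_emeasure_le_1 simp del: mult_1_right intro!: mult_left_mono)
    finally show "(\<integral>\<^sup>+ (s2, t2). of_nat t1 + of_nat t2 \<partial>measure_spmf (k s1)) \<le> of_nat t1 + ennreal T'"
      by simp
  qed
  also have "\<dots> = (\<integral>\<^sup>+ x. of_nat (snd x) \<partial>measure_spmf p) + (\<integral>\<^sup>+ x. ennreal T' \<partial>measure_spmf p)"
    by (subst nn_integral_add[symmetric]) (auto simp: case_prod_unfold)
  also have "\<dots> \<le> ennreal T + ennreal T' * 1"
    using p by (intro add_mono)
      (auto simp: runs_in_iff measure_spmf.subprob_emeasure_le_1 simp del: mult_1_right intro!: mult_left_mono)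
  also have "\<dots> = ennreal (T + T')" using T T' by simp
  finally show ?thesis
    using p k T T' by (fastforce simp: runs_in_iff set_bind_spmf)
qed

lemma runs_in_map:
  assumes "runs_in p T A" and "\<And>v. A v \<Longrightarrow> B (f v)"
  shows "runs_in (map_spmf (\<lambda>(v, t). (f v, t + m)) p) (T + real m) B"
proof -
  have eq: "map_spmf (\<lambda>(v, t). (f v, t + m)) p =
    bind_spmf p (\<lambda>(s1, t1). bind_spmf (return_spmf (f s1, m)) (\<lambda>(s2, t2). return_spmf (s2, t1 + t2)))"
    by (simp add: map_spmf_conv_bind_spmf case_prod_unfold)
  show ?thesis unfolding eq using assms(2) by (intro runs_in_bind[OF assms(1)]) auto
qed

text \<open>The initial state is spelled out so that simplification can read the argument registers
  during symbolic execution.\<close>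

lemma runs_in_run:
  assumes "runs_in (exec w prim c (\<lambda>i. if i < length args then args ! i else zero_val, \<lambda>_. zero_val)) T
    (\<lambda>(R, M). Q (R 0))"
  shows "runs_in (run w prim c args) T Q"
  using assms unfolding init_state_def[symmetric]
  using runs_in_map[where m = 0 and B = Q and f = "\<lambda>(R, M). R 0" and A = "\<lambda>(R, M). Q (R 0)"]
  by (auto simp: run_def case_prod_unfold)

abbreviation seq (infixr ";;" 60) where "c1 ;; c2 \<equiv> Seq c1 c2"

lemma runs_in_Seq:
  assumes "runs_in (exec w prim c1 s) T A" and "\<And>R M. A (R, M) \<Longrightarrow> runs_in (exec w prim c2 (R, M)) T' B"
  shows "runs_in (exec w prim (c1 ;; c2) s) (T + T') B"
  unfolding exec.simps by (rule runs_in_bind[OF assms(1)]) (use assms(2) in auto)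

lemma runs_in_Call:
  assumes "runs_in (run w prim c (map R is)) T A" and "\<And>v. A v \<Longrightarrow> B (R(r := v), M)"
  shows "runs_in (exec w prim (Call r c is) (R, M)) (T + 1) B"
proof -
  have eq: "exec w prim (Call r c is) (R, M) =
     map_spmf (\<lambda>(v, t). ((R(r := v), M), t + 1)) (run w prim c (map R is))"
    by (simp add: run_def spmf.map_comp o_def case_prod_unfold)
  show ?thesis unfolding eq using runs_in_map[where m = 1 and f = "\<lambda>v. (R(r := v), M)" and B = B, OF assms] by simp
qed

lemma runs_in_If:
  assumes "R i \<noteq> zero_val \<Longrightarrow> runs_in (exec w prim c1 (R, M)) T B"
    and "R i = zero_val \<Longrightarrow> runs_in (exec w prim c2 (R, M)) T B"
  shows "runs_in (exec w prim (If i c1 c2) (R, M)) (T + 1) B"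
  using runs_in_map[where m = 1 and f = "\<lambda>v. v" and T = T and A = B and B = B and
      p = "if R i \<noteq> zero_val then exec w prim c1 (R, M) else exec w prim c2 (R, M)"] assms
  by (auto simp: case_prod_unfold)

text \<open>The ghost \<open>g\<close> carries the abstract value of the state; the potential \<open>\<phi> g\<close> pays for the
  remaining iterations.\<close>

lemma runs_in_While:
  assumes step: "\<And>g R M. I g (R, M) \<Longrightarrow> R i \<noteq> zero_val \<Longrightarrow>
      \<exists>T. runs_in (exec w prim c (R, M)) T (\<lambda>s'. \<exists>g'. I g' s' \<and> T + 1 + \<phi> g' \<le> \<phi> g)"
    and pos: "\<And>g s. I g s \<Longrightarrow> 1 \<le> \<phi> g"
    and "I g s"
  shows "runs_in (exec w prim (While i c) s) (\<phi> g) (\<lambda>s'. \<exists>g'. I g' s' \<and> fst s' i = zero_val)"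
proof -
  \<comment> \<open>Induction on an integer above the potential: every iteration pays 1 for the loop
    test, so the potential drops by at least 1, and \<open>pos\<close> excludes
    \<open>m = 0\<close>.\<close>
  have "\<phi> g \<le> real m \<Longrightarrow> I g s \<Longrightarrow> runs_in (exec w prim (While i c) s) (\<phi> g) (\<lambda>s'. \<exists>g'. I g' s' \<and> fst s' i = zero_val)" for m
  proof (induction m arbitrary: g s)
    case 0
    then show ?case using pos[of g s] by simp
  next
    case (Suc m)
    show ?case
    proof (cases "fst s i = zero_val")
      case True
      then show ?thesis using Suc.prems pos[of g s]
        by (auto simp: while_loop.simps)
    next
      case False
      obtain R M where s: "s = (R, M)" by (cases s)
      then obtain T where T: "runs_in (exec w prim c s) T (\<lambda>s'. \<exists>g'. I g' s' \<and> T + 1 + \<phi> g' \<le> \<phi> g)"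
        using step Suc.prems False by fastforce
      then have "0 \<le> T" by (simp add: runs_in_iff)
      have eq: "exec w prim (While i c) s = map_spmf (\<lambda>(v, t). (v, t + 1))
         (bind_spmf (exec w prim c s) (\<lambda>(s1, t1). bind_spmf (exec w prim (While i c) s1) (\<lambda>(s2, t2). return_spmf (s2, t1 + t2))))"
        using False by (subst exec.simps, subst while_loop.simps)
          (simp add: map_spmf_bind_spmf o_def case_prod_unfold)
      have "runs_in (exec w prim (While i c) s) ((T + (\<phi> g - T - 1)) + real 1) (\<lambda>s'. \<exists>g'. I g' s' \<and> fst s' i = zero_val)"
        unfolding eq
      proof (rule runs_in_map, rule runs_in_bind[OF T])
        fix s' assume "\<exists>g'. I g' s' \<and> T + 1 + \<phi> g' \<le> \<phi> g"
        then obtain g' where g': "I g' s'" "T + 1 + \<phi> g' \<le> \<phi> g" by blast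
        with \<open>0 \<le> T\<close> Suc.prems have "\<phi> g' \<le> real m" by simp
        from Suc.IH[OF this g'(1)]
        show "runs_in (exec w prim (While i c) s') (\<phi> g - T - 1) (\<lambda>s'. \<exists>g'. I g' s' \<and> fst s' i = zero_val)"
          by (rule runs_in_weaken) (use g' in auto)
      qed auto
      then show ?thesis by simp
    qed
  qed
  from this[OF real_nat_ceiling_ge assms(3)] show ?thesis .
qed

section \<open>Symbolic execution against a remaining time budget\<close>

lemma runs_in_SeqI:
  assumes "runs_in (exec w prim c1 s) T' A" and "\<And>R M. A (R, M) \<Longrightarrow> runs_in (exec w prim c2 (R, M)) (T - T') B"
  shows "runs_in (exec w prim (c1 ;; c2) s) T B"
  using runs_in_Seq[OF assms] by simp

lemma runs_in_step:
  assumes "exec w prim c1 (R, M) = return_spmf ((R', M'), t)" and "runs_in (exec w prim c2 (R', M')) (T - real t) B"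
  shows "runs_in (exec w prim (c1 ;; c2) (R, M)) T B"
  by (rule runs_in_SeqI[where T' = "real t" and A = "\<lambda>s. s = (R', M')"]) (use assms in auto)

text \<open>Each rule takes one instruction from the front and subtracts its cost from the budget
  \<open>T\<close>, so the arithmetic is settled once, at the end of a block, where what remains
  must cover the last instruction.\<close>

lemma runs_in_instr:
  "runs_in (exec w prim c (R(r := word w n), M)) (T - 1) Q \<Longrightarrow>
     runs_in (exec w prim (Const r n ;; c) (R, M)) T Q"
  "runs_in (exec w prim c (R(r := R i), M)) (T - 1) Q \<Longrightarrow>
     runs_in (exec w prim (Move r i ;; c) (R, M)) T Q"
  "runs_in (exec w prim c (R(r := word w (arith_op w f (word_of (R i)) (word_of (R j)))), M)) (T - 1) Q \<Longrightarrow>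
     runs_in (exec w prim (Arith r f i j ;; c) (R, M)) T Q"
  "runs_in (exec w prim c (R(r := M (word_of (R i))), M)) (T - 1) Q \<Longrightarrow>
     runs_in (exec w prim (Load r i ;; c) (R, M)) T Q"
  "runs_in (exec w prim c (R, M(word_of (R i) := R j))) (T - 1) Q \<Longrightarrow>
     runs_in (exec w prim (Store i j ;; c) (R, M)) T Q"
  "runs_in (exec w prim c (R(r := word w (length (elems_of (R i)))), M)) (T - 1) Q \<Longrightarrow>
     runs_in (exec w prim (Length r i ;; c) (R, M)) T Q"
  "runs_in (exec w prim c (R(r := (if word_of (R j) < length (elems_of (R i))
       then elems_of (R i) ! word_of (R j) else zero_val)), M)) (T - 1) Q \<Longrightarrow>
     runs_in (exec w prim (Index r i j ;; c) (R, M)) T Q"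
  by (rule runs_in_step[where t = 1]; simp add: Let_def)+

lemma runs_in_Seq_Call:
  assumes "runs_in (run w prim c' (map R is)) T' A"
    and "\<And>v. A v \<Longrightarrow> runs_in (exec w prim c (R(r := v), M)) (T - T' - 1) B"
  shows "runs_in (exec w prim (Call r c' is ;; c) (R, M)) T B"
proof (rule runs_in_SeqI)
  show "runs_in (exec w prim (Call r c' is) (R, M)) (T' + 1) (\<lambda>s. \<exists>v. A v \<and> s = (R(r := v), M))"
    by (rule runs_in_Call[OF assms(1)]) auto
qed (use assms(2) in \<open>auto simp: algebra_simps\<close>)

lemma runs_in_CallI:
  assumes "runs_in (run w prim c' (map R is)) T' A" and "T' + 1 \<le> T" and "\<And>v. A v \<Longrightarrow> B (R(r := v), M)"
  shows "runs_in (exec w prim (Call r c' is) (R, M)) T B"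
  by (rule runs_in_weaken[OF runs_in_Call[OF assms(1), where B = B]]) (use assms(2,3) in auto)

lemma exec_Seq_Seq: "exec w prim ((c1 ;; c2) ;; c3) s = exec w prim (c1 ;; (c2 ;; c3)) s"
  by (simp add: case_prod_unfold add.assoc)

lemma exec_Seq_If:
  "exec w prim (If i c1 c2 ;; c) s = map_spmf (\<lambda>(v, t). (v, t + 1)) (exec w prim ((if fst s i \<noteq> zero_val then c1 else c2) ;; c) s)"
  by (simp add: case_prod_unfold bind_map_spmf map_spmf_bind_spmf o_def)

lemma runs_in_Seq_Seq:
  "runs_in (exec w prim (c1 ;; (c2 ;; c3)) s) T B \<Longrightarrow> runs_in (exec w prim ((c1 ;; c2) ;; c3) s) T B"
  by (simp only: exec_Seq_Seq)

text \<open>The continuation \<open>c\<close> is copied into both branches, so no common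
  postcondition of the branches has to be invented.\<close>

lemma runs_in_Seq_If:
  assumes "R i \<noteq> zero_val \<Longrightarrow> runs_in (exec w prim (c1 ;; c) (R, M)) (T - 1) B"
    and "R i = zero_val \<Longrightarrow> runs_in (exec w prim (c2 ;; c) (R, M)) (T - 1) B"
  shows "runs_in (exec w prim (If i c1 c2 ;; c) (R, M)) T B"
  using runs_in_map[where m = 1 and f = "\<lambda>v. v" and T = "T - 1" and A = B and B = B and
      p = "exec w prim ((if R i \<noteq> zero_val then c1 else c2) ;; c) (R, M)"] assms
  unfolding exec_Seq_If by (auto simp del: exec.simps)

lemma runs_in_IfI:
  assumes "R i \<noteq> zero_val \<Longrightarrow> runs_in (exec w prim c1 (R, M)) (T - 1) B"
    and "R i = zero_val \<Longrightarrow> runs_in (exec w prim c2 (R, M)) (T - 1) B"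
  shows "runs_in (exec w prim (If i c1 c2) (R, M)) T B"
  using runs_in_If[of R i w prim c1 M "T - 1" B c2] assms by simp

lemma runs_in_Seq_While:
  fixes I :: "'g \<Rightarrow> 'a state \<Rightarrow> bool" and \<phi> :: "'g \<Rightarrow> real"
  assumes "I g (R, M)" and "\<And>g s. I g s \<Longrightarrow> 1 \<le> \<phi> g"
    and "\<And>g R M. I g (R, M) \<Longrightarrow> R i \<noteq> zero_val \<Longrightarrow>
      \<exists>T. runs_in (exec w prim c (R, M)) T (\<lambda>s'. \<exists>g'. I g' s' \<and> T + 1 + \<phi> g' \<le> \<phi> g)"
    and "\<And>g' R M. I g' (R, M) \<Longrightarrow> R i = zero_val \<Longrightarrow> runs_in (exec w prim c' (R, M)) (T - \<phi> g) B"
  shows "runs_in (exec w prim (While i c ;; c') (R, M)) T B"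
  by (rule runs_in_SeqI[OF runs_in_While[where I = I and \<phi> = \<phi> and g = g]]) (use assms in auto)

section \<open>Linked lists as nested immutable arrays\<close>

primrec list_val :: "'a val list \<Rightarrow> 'a val" where
  "list_val [] = zero_val"
| "list_val (v # vs) = Arr [v, list_val vs]"

text \<open>The empty list is the value that \<open>While\<close> and \<open>If\<close> treat as
  false, so a register holding a list serves as its own loop condition.\<close>

lemma list_val_eq_zero [simp]: "list_val vs = zero_val \<longleftrightarrow> vs = []"
  by (cases vs) auto

text \<open>
  Consing by a subprogram does not touch the memory of the caller, so linked lists of nested arrays
  can coexist with arbitrary uses of memory. Registers that a program never writes provide the
  constant 0.
\<close>

definition cons_com :: "'o com" where
  "cons_com = Const 2 0 ;; Store 2 0 ;; Const 3 1 ;; Store 3 1 ;; Const 4 2 ;; Freeze 0 2 4"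

lemma run_cons:
  assumes "2 \<le> w"
  shows "runs_in (run w prim cons_com [u, v]) 8 (\<lambda>x. x = Arr [u, v])"
proof -
  have "2 ^ 2 \<le> (2::nat) ^ w" using assms by (intro power_increasing) auto
  then have "(1::nat) < 2 ^ w" "(2::nat) < 2 ^ w" by simp_all
  then show ?thesis unfolding cons_com_def
    by (intro runs_in_run runs_in_instr) (use assms in \<open>simp add: upt_rec[of _ 2]\<close>)
qed

lemma runs_in_cons:
  assumes "2 \<le> w" and "runs_in (exec w prim c (R(r := Arr [R i, R j]), M)) (T - 9) Q"
  shows "runs_in (exec w prim (Call r cons_com [i, j] ;; c) (R, M)) T Q"
  by (rule runs_in_Seq_Call[where A = "\<lambda>v. v = Arr [R i, R j]" and T' = 8]) (use assms run_cons in auto)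

definition to_array_com :: "'o com" where
  "to_array_com = Const 3 1 ;;
     While 0 (Index 4 0 2 ;; Store 1 4 ;; Index 0 0 3 ;; Arith 1 Add 1 3) ;; Freeze 0 2 1"

lemma run_to_array:
  assumes "length vs < 2 ^ w" and "1 \<le> w"
  shows "runs_in (run w prim to_array_com [list_val vs]) (6 * real (length vs) + 3) (\<lambda>v. v = Arr vs)"
proof -
  have w: "(1::nat) < 2 ^ w" using assms(2) using one_less_power[of "2::nat" w] by simp
  define I where "I j s = (case s of (R, M) \<Rightarrow> j \<le> length vs \<and> R 0 = list_val (drop j vs) \<and> R 1 = Scalar (Word j) \<and>
     R 2 = zero_val \<and> R 3 = Scalar (Word 1) \<and> (\<forall>i<j. M i = vs ! i))" for j and s :: "'a state"
  show ?thesis unfolding to_array_com_def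
  proof (intro runs_in_run runs_in_instr, rule runs_in_Seq_While[where I = I and g = 0 and \<phi> = "\<lambda>j. 5 * real (length vs - j) + 1"])
    fix j R M assume I: "I j (R, M)" and "R 0 \<noteq> zero_val"
    then have j: "j < length vs" by (auto simp: I_def)
    then have "list_val (drop j vs) = Arr [vs ! j, list_val (drop (Suc j) vs)]"
      by (simp flip: Cons_nth_drop_Suc)
    then show "\<exists>T. runs_in (exec w prim (Index 4 0 2 ;; Store 1 4 ;; Index 0 0 3 ;; Arith 1 Add 1 3) (R, M)) T
       (\<lambda>s'. \<exists>g'. I g' s' \<and> T + 1 + (5 * real (length vs - g') + 1) \<le> 5 * real (length vs - j) + 1)"
      using I j assms by (intro exI[of _ 4]) (auto simp: I_def nth_append less_Suc_eq intro!: exI[of _ "Suc j"])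
  next
    fix j R M assume I: "I j (R, M)" and "R 0 = zero_val"
    then have "list_val (drop j vs) = zero_val" by (simp add: I_def)
    then have "j = length vs" using I by (simp add: I_def)
    with I show "runs_in (exec w prim (Freeze 0 2 1) (R, M)) (6 * real (length vs) + 3 - 1 - (5 * real (length vs - 0) + 1)) (\<lambda>(R, M). R 0 = Arr vs)"
      using assms by (auto simp: I_def Let_def intro!: nth_equalityI)
  qed (use assms in \<open>auto simp: I_def w\<close>)
qed

section \<open>Multiply-shift hashing and the search tree\<close>

definition hash :: "nat \<Rightarrow> nat \<Rightarrow> nat \<Rightarrow> nat" where
  "hash N x y = (2 * x + 1) * y mod N"

lemma hash_less: "0 < N \<Longrightarrow> hash N x y < N"
  by (simp add: hash_def)

text \<open>Color numbers run from 1 to \<open>2 ^ L\<close>, because 0 marks colors not yet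
  numbered. As their differences stay below the modulus, they are still distinct residues.\<close>

lemma abs_diff_less_power:
  assumes "y \<in> {1..2 ^ L}" and "z \<in> {1..2 ^ L}"
  shows "\<bar>int y - int z\<bar> < 2 ^ L"
proof -
  have "int y \<le> int (2 ^ L)" "int z \<le> int (2 ^ L)"
    using assms by (auto simp only: of_nat_le_iff atLeastAtMost_iff)
  moreover have "1 \<le> int y" "1 \<le> int z" using assms by auto
  ultimately have "\<bar>int y - int z\<bar> < int (2 ^ L)" by linarith
  then show ?thesis by simp
qed

text \<open>An odd multiplier is invertible modulo a power of two. Thus no two colors share a leaf,
  and the descent never has to go below one.\<close>

lemma inj_on_hash: "inj_on (hash (2 ^ L) x) {1..2 ^ L}"
proof (rule inj_onI)
  fix y z :: nat assume y: "y \<in> {1..2 ^ L}" and z: "z \<in> {1..2 ^ L}" and eq: "hash (2 ^ L) x y = hash (2 ^ L) x z"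
  have "int ((2 * x + 1) * y mod 2 ^ L) = int ((2 * x + 1) * z mod 2 ^ L)"
    using eq by (simp add: hash_def)
  then have "2 ^ L dvd int ((2 * x + 1) * y) - int ((2 * x + 1) * z)"
    by (simp only: zmod_int mod_eq_dvd_iff of_nat_power of_nat_numeral)
  then have "2 ^ L dvd (2 * int x + 1) * (int y - int z)" by (simp add: algebra_simps)
  moreover have "coprime (2 ^ L) (2 * int x + 1)" by simp
  ultimately have "2 ^ L dvd int y - int z" by (simp add: coprime_dvd_mult_right_iff)
  moreover have "\<bar>int y - int z\<bar> < 2 ^ L"
    using y z by (rule abs_diff_less_power)
  ultimately show "y = z" using zdvd_not_zless[of "\<bar>int y - int z\<bar>" "2 ^ L"] by force
qed

lemma two_power_odd_decomp: "(d::int) \<noteq> 0 \<Longrightarrow> \<exists>e c. odd c \<and> d = 2 ^ e * c"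
proof (induction "nat \<bar>d\<bar>" arbitrary: d rule: less_induct)
  case less
  show ?case
  proof (cases "odd d")
    case True
    then show ?thesis by (intro exI[of _ 0] exI[of _ d]) simp
  next
    case False
    then obtain d' where d': "d = 2 * d'" by blast
    with less.prems have "nat \<bar>d'\<bar> < nat \<bar>d\<bar>" "d' \<noteq> 0" by auto
    from less.hyps[OF this] obtain e c where "odd c" "d' = 2 ^ e * c" by blast
    with d' show ?thesis by (intro exI[of _ "Suc e"] exI[of _ c]) simp
  qed
qed

text \<open>
  Multiply-shift hashing. If \<open>y - z = 2 ^ e * c\<close> with \<open>c\<close> odd, then a collision forces
  \<open>(2 * x + 1) * c\<close> to be congruent modulo \<open>2 ^ (L - e)\<close> to one of the few odd numbers \<open>r\<close> of
  absolute value below \<open>2 ^ (L - i - e)\<close>, and \<open>x\<close> is determined by \<open>r\<close> and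
  \<open>x div 2 ^ (L - e - 1)\<close>.
\<close>

lemma card_hash_collisions:
  fixes L m i y z :: nat
  assumes "i \<le> L" and "L \<le> m + 1" and y: "y \<in> {1..2 ^ L}" and z: "z \<in> {1..2 ^ L}" and "y \<noteq> z"
  defines "C \<equiv> {x. x < 2 ^ m \<and> hash (2 ^ L) x y div 2 ^ (L - i) = hash (2 ^ L) x z div 2 ^ (L - i)}"
  shows "card C * 2 ^ i \<le> 2 * 2 ^ m"
proof -
  define d where "d = int y - int z"
  have "d \<noteq> 0" using \<open>y \<noteq> z\<close> by (simp add: d_def)
  then obtain e c where c: "odd c" and d: "d = 2 ^ e * c" using two_power_odd_decomp by blast
  \<comment> \<open>The signed difference of the two ranks, not reduced modulo \<open>2 ^ L\<close>:
    a collision makes it small, while the congruence \<open>cong\<close> ties it to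
    \<open>d\<close>.\<close>
  define \<delta> where "\<delta> x = int (hash (2 ^ L) x y) - int (hash (2 ^ L) x z)" for x
  have "\<bar>d\<bar> < 2 ^ L"
    unfolding d_def using y z by (rule abs_diff_less_power)
  moreover have "(2::int) ^ e \<le> \<bar>d\<bar>"
  proof -
    have "c \<noteq> 0" using c by auto
    then have "2 ^ e * 1 \<le> (2::int) ^ e * \<bar>c\<bar>" by (intro mult_left_mono) auto
    then show ?thesis by (simp add: d abs_mult)
  qed
  ultimately have "(2::int) ^ e < 2 ^ L" by linarith
  then have e: "e < L" by simp
  have cong: "2 ^ L dvd (2 * int x + 1) * d - \<delta> x" for x
  proof -
    have *: "2 ^ L dvd (2 * int x + 1) * int v - int (hash (2 ^ L) x v)" for v
    proof -
      have "int (hash (2 ^ L) x v) = (2 * int x + 1) * int v mod 2 ^ L"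
        by (simp add: hash_def zmod_int algebra_simps)
      then show ?thesis by (simp add: dvd_minus_mod)
    qed
    have "(2 * int x + 1) * d - \<delta> x =
       ((2 * int x + 1) * int y - int (hash (2 ^ L) x y)) - ((2 * int x + 1) * int z - int (hash (2 ^ L) x z))"
      by (simp add: d_def \<delta>_def algebra_simps)
    then show ?thesis using dvd_diff[OF *[of y] *[of z]] by simp
  qed
  define r where "r x = \<delta> x div 2 ^ e" for x
  have \<delta>: "\<delta> x = 2 ^ e * r x" for x
  proof -
    have "(2::int) ^ e dvd 2 ^ L" using e by (simp add: le_imp_power_dvd)
    then have "2 ^ e dvd (2 * int x + 1) * d - \<delta> x" using cong dvd_trans by blast
    moreover have "2 ^ e dvd (2 * int x + 1) * d" by (simp add: d)
    ultimately have "2 ^ e dvd \<delta> x" by (metis dvd_diff_right_iff)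
    then show ?thesis by (simp add: r_def)
  qed
  have cong_r: "2 ^ (L - e) dvd (2 * int x + 1) * c - r x" for x
  proof -
    have "(2::int) ^ L = 2 ^ e * 2 ^ (L - e)" using e by (simp flip: power_add)
    moreover have "(2 * int x + 1) * d - \<delta> x = 2 ^ e * ((2 * int x + 1) * c - r x)"
      by (simp add: \<delta> d algebra_simps)
    ultimately show ?thesis using cong[of x] by simp
  qed
  have odd_r: "odd (r x)" for x
  proof -
    have "(2::int) dvd 2 ^ (L - e)" using e by simp
    then have "2 dvd (2 * int x + 1) * c - r x" using cong_r dvd_trans by blast
    then show ?thesis using c by simp
  qed
  have small: "\<bar>\<delta> x\<bar> < 2 ^ (L - i)" if "x \<in> C" for x
  proof -
    let ?s = "2 ^ (L - i) :: nat" and ?y = "hash (2 ^ L) x y" and ?z = "hash (2 ^ L) x z"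
    have "?y div ?s = ?z div ?s" using that by (simp add: C_def)
    then obtain q where "?y = q + ?y mod ?s" "?z = q + ?z mod ?s"
      by (metis div_mult_mod_eq)
    then have "\<delta> x = int (?y mod ?s) - int (?z mod ?s)"
      unfolding \<delta>_def by linarith
    moreover have "?y mod ?s < ?s" "?z mod ?s < ?s" by simp_all
    then have "int (?y mod ?s) < 2 ^ (L - i)" "int (?z mod ?s) < 2 ^ (L - i)"
      by (metis of_nat_less_iff of_nat_numeral of_nat_power)+
    ultimately show ?thesis by linarith
  qed
  show ?thesis
  proof (cases "e \<le> L - i")
    \<comment> \<open>Here \<open>2 ^ e\<close> is at least the bucket width
      \<open>2 ^ (L - i)\<close>, and since \<open>r x\<close> is odd, \<open>\<delta> x\<close> is
      a nonzero multiple of \<open>2 ^ e\<close>; so there is no collision at all.\<close>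
    case False
    have "C = {}"
    proof (rule ccontr)
      assume "C \<noteq> {}"
      then obtain x where x: "x \<in> C" by blast
      have "(2::int) ^ (L - i) \<le> 2 ^ e" using False by simp
      moreover have "2 ^ e * 1 \<le> 2 ^ e * \<bar>r x\<bar>" using odd_r[of x] by (intro mult_left_mono) (cases "r x = 0", auto)
      moreover have "\<bar>\<delta> x\<bar> = 2 ^ e * \<bar>r x\<bar>" by (simp add: \<delta> abs_mult)
      ultimately show False using small[OF x] by linarith
    qed
    then show ?thesis by simp
  next
    case True
    define t where "t = L - i - e"
    have "2 ^ (L - i) = (2::int) ^ e * 2 ^ t" using True by (simp add: t_def flip: power_add)
    then have r: "\<bar>r x\<bar> < 2 ^ t" if "x \<in> C" for x
      using small[OF that] by (simp add: \<delta> abs_mult)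
    \<comment> \<open>The first component numbers the odd integers between \<open>- (2 ^ t)\<close>
      and \<open>2 ^ t\<close> consecutively from 0; the second consists of the leading bits of
      \<open>x\<close>, which the congruence leaves free.\<close>
    define f where "f x = (nat ((r x + 2 ^ t) div 2), x div 2 ^ (L - e - 1))" for x
    have "f ` C \<subseteq> {..<2 ^ t} \<times> {..<2 ^ (m - (L - e - 1))}"
    proof (rule image_subsetI)
      fix x assume x: "x \<in> C"
      have "nat ((r x + 2 ^ t) div 2) < 2 ^ t"
        using r[OF x] by (simp add: nat_less_iff)
      moreover have "x < 2 ^ (L - e - 1) * 2 ^ (m - (L - e - 1))"
        using x assms(2) by (simp add: C_def flip: power_add)
      then have "x div 2 ^ (L - e - 1) < 2 ^ (m - (L - e - 1))"
        by (simp add: less_mult_imp_div_less mult.commute)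
      ultimately show "f x \<in> {..<2 ^ t} \<times> {..<2 ^ (m - (L - e - 1))}" by (simp add: f_def)
    qed
    moreover have "inj_on f C"
    proof (rule inj_onI)
      fix x x' assume x: "x \<in> C" "x' \<in> C" and eq: "f x = f x'"
      have "r x + 2 ^ t \<ge> 0" "r x' + 2 ^ t \<ge> 0" using r[OF x(1)] r[OF x(2)] by auto
      then have "(r x + 2 ^ t) div 2 = (r x' + 2 ^ t) div 2"
        using eq by (auto simp: f_def eq_nat_nat_iff)
      moreover have "(r x + 2 ^ t) mod 2 = (r x' + 2 ^ t) mod 2"
        using odd_r[of x] odd_r[of x'] by (metis mod_add_cong odd_iff_mod_2_eq_one)
      ultimately have "r x = r x'" by (metis add_right_cancel div_mult_mod_eq)
      then have "2 ^ (L - e) dvd ((2 * int x + 1) * c - r x) - ((2 * int x' + 1) * c - r x)"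
        using dvd_diff[OF cong_r[of x] cong_r[of x']] by simp
      also have "((2 * int x + 1) * c - r x) - ((2 * int x' + 1) * c - r x) = 2 * ((int x - int x') * c)"
        by (simp add: algebra_simps)
      finally have "2 * 2 ^ (L - e - 1) dvd 2 * ((int x - int x') * c)"
        using e by (simp flip: power_Suc add: Suc_diff_Suc)
      then have "2 ^ (L - e - 1) dvd (int x - int x') * c" by simp
      moreover have "coprime (2 ^ (L - e - 1)) c" using c by simp
      ultimately have "2 ^ (L - e - 1) dvd int x - int x'"
        by (simp add: coprime_dvd_mult_left_iff)
      then have "int x mod 2 ^ (L - e - 1) = int x' mod 2 ^ (L - e - 1)"
        by (simp add: mod_eq_dvd_iff)
      then have "int (x mod 2 ^ (L - e - 1)) = int (x' mod 2 ^ (L - e - 1))"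
        by (simp add: zmod_int)
      then have "x mod 2 ^ (L - e - 1) = x' mod 2 ^ (L - e - 1)" by simp
      moreover have "x div 2 ^ (L - e - 1) = x' div 2 ^ (L - e - 1)"
        using eq by (simp add: f_def)
      ultimately show "x = x'" by (metis div_mult_mod_eq)
    qed
    ultimately have "card C \<le> card ({..<2 ^ t} \<times> {..<2 ^ (m - (L - e - 1))} :: (nat \<times> nat) set)"
      by (intro card_inj_on_le) auto
    then have "card C \<le> 2 ^ (t + (m - (L - e - 1)))" by (simp add: card_cartesian_product power_add)
    then have "card C * 2 ^ i \<le> 2 ^ (t + (m - (L - e - 1)) + i)"
      by (simp add: power_add)
    \<comment> \<open>The truncated subtractions are exact because of \<open>L \<le> m + 1\<close>;
      the surplus 1 in the exponent is the factor 2 of the claim.\<close>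
    also have "t + (m - (L - e - 1)) + i = Suc m"
      using True assms(1,2) e by (simp add: t_def)
    finally show ?thesis by simp
  qed
qed

section \<open>Ancestors in the heap numbering\<close>

definition anc :: "nat \<Rightarrow> nat \<Rightarrow> bool" where
  "anc v u \<longleftrightarrow> (\<exists>j. u div 2 ^ j = v)"

lemma anc_refl [simp]: "anc v v"
  unfolding anc_def by (rule exI[of _ 0]) simp

lemma anc_le: "anc v u \<Longrightarrow> v \<le> u"
  by (auto simp: anc_def)

lemma anc_half: "anc v u \<Longrightarrow> anc (v div 2) u"
  unfolding anc_def by (metis div_mult2_eq power_Suc2)

lemma anc_iff_half: "anc v u \<longleftrightarrow> u = v \<or> anc v (u div 2)"
proof
  assume "anc v u"
  then obtain j where "u div 2 ^ j = v" by (auto simp: anc_def)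
  then show "u = v \<or> anc v (u div 2)"
    by (cases j) (auto simp: anc_def div_mult2_eq)
next
  assume "u = v \<or> anc v (u div 2)"
  then show "anc v u"
  proof
    assume "anc v (u div 2)"
    then obtain j where "u div 2 div 2 ^ j = v" by (auto simp: anc_def)
    then have "u div 2 ^ Suc j = v" by (simp add: div_mult2_eq)
    then show ?thesis unfolding anc_def by blast
  qed simp
qed

lemma anc_iff_children: "anc v u \<longleftrightarrow> u = v \<or> anc (2 * v) u \<or> anc (2 * v + 1) u"
proof
  assume "anc v u"
  then obtain j where j: "u div 2 ^ j = v" by (auto simp: anc_def)
  show "u = v \<or> anc (2 * v) u \<or> anc (2 * v + 1) u"
  proof (cases j)
    case 0
    then show ?thesis using j by simp
  next
    case (Suc i)
    then have "(u div 2 ^ i) div 2 = v" using j by (metis div_mult2_eq power_Suc2)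
    then have "u div 2 ^ i = 2 * v \<or> u div 2 ^ i = 2 * v + 1" by linarith
    then show ?thesis by (auto simp: anc_def)
  qed
next
  have "anc v u" if w: "anc w u" "w div 2 = v" for w
  proof -
    obtain j where "u div 2 ^ j = w" using w(1) unfolding anc_def by blast
    then have "u div 2 ^ Suc j = v" using w(2) by (metis div_mult2_eq power_Suc2)
    then show ?thesis unfolding anc_def by blast
  qed
  then show "u = v \<or> anc (2 * v) u \<or> anc (2 * v + 1) u \<Longrightarrow> anc v u"
    by (metis anc_refl even_succ_div_two dvd_triv_left nonzero_mult_div_cancel_left zero_neq_numeral)
qed

text \<open>Each further shift at least halves the quotient, so siblings cannot both be quotients of
  \<open>u\<close>. For \<open>v = 0\<close> the two indices would be 0 and 1, both of which are
  ancestors of every positive \<open>u\<close>.\<close>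

lemma anc_children_disjoint:
  assumes "1 \<le> v" shows "\<not> (anc (2 * v) u \<and> anc (2 * v + 1) u)"
proof
  assume "anc (2 * v) u \<and> anc (2 * v + 1) u"
  then obtain i j where i: "u div 2 ^ i = 2 * v" and j: "u div 2 ^ j = 2 * v + 1" by (auto simp: anc_def)
  have le: "u div 2 ^ b \<le> u div 2 ^ a div 2" if "a < b" for a b
  proof -
    have "u div 2 ^ b = u div 2 ^ Suc a div 2 ^ (b - Suc a)"
      using that by (simp flip: div_mult2_eq power_add del: power_Suc)
    also have "\<dots> \<le> u div 2 ^ Suc a" by simp
    finally show ?thesis by (simp only: div_mult2_eq power_Suc2)
  qed
  show False
    using le[of i j] le[of j i] i j assms by (cases i j rule: linorder_cases) auto
qed

lemma anc_root: "1 \<le> u \<Longrightarrow> anc 1 u"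
proof (induction u rule: less_induct)
  case (less u)
  show ?case
  proof (cases "u = 1")
    case False
    then have "anc 1 (u div 2)" using less by simp
    then show ?thesis using anc_iff_half by blast
  qed simp
qed

lemma anc_leaf: "N \<le> v \<Longrightarrow> u < 2 * N \<Longrightarrow> anc v u \<Longrightarrow> v = u"
  using anc_le[of v "u div 2"] anc_iff_half[of v u] by fastforce

text \<open>Only the shifts by 0 to \<open>L\<close> leave a positive quotient. Index 0 is no node,
  but \<open>anc 0 u\<close> always holds, hence the guard \<open>1 \<le> v\<close>.\<close>

lemma card_anc_le:
  assumes "u < 2 ^ Suc L" shows "card {v. 1 \<le> v \<and> anc v u} \<le> Suc L"
proof -
  have "{v. 1 \<le> v \<and> anc v u} \<subseteq> (\<lambda>j. u div 2 ^ j) ` {..L}"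
  proof
    fix v assume "v \<in> {v. 1 \<le> v \<and> anc v u}"
    then obtain j where j: "u div 2 ^ j = v" "1 \<le> v" by (auto simp: anc_def)
    have "j \<le> L"
    proof (rule ccontr)
      assume "\<not> j \<le> L"
      then have "(2::nat) ^ Suc L \<le> 2 ^ j" by (intro power_increasing) auto
      then have "u < 2 ^ j" using assms by linarith
      then show False using j by simp
    qed
    then show "v \<in> (\<lambda>j. u div 2 ^ j) ` {..L}" using j by blast
  qed
  from card_mono[OF _ this] have "card {v. 1 \<le> v \<and> anc v u} \<le> card ((\<lambda>j. u div 2 ^ j) ` {..L})" by simp
  also have "\<dots> \<le> Suc L" using card_image_le[of "{..L}"] by simp
  finally show ?thesis .
qed

text \<open>The ancestor at depth \<open>i\<close> is \<open>2 ^ i\<close> plus the number formed by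
  the \<open>i\<close> leading bits of the rank. Two colors can thus meet at depth \<open>i\<close>
  only if these bits agree, the event bounded by \<open>card_hash_collisions\<close>.\<close>

lemma anc_level:
  assumes "i \<le> L" "h < 2 ^ L" "2 ^ i \<le> v" "v < 2 ^ Suc i" "anc v (2 ^ L + h)"
  shows "v = 2 ^ i + h div 2 ^ (L - i)"
proof -
  obtain j where j: "(2 ^ L + h) div 2 ^ j = v" using assms by (auto simp: anc_def)
  have "j \<le> L"
  proof (rule ccontr)
    assume "\<not> j \<le> L"
    then have "(2::nat) ^ Suc L \<le> 2 ^ j" by (intro power_increasing) auto
    then have "2 ^ L + h < 2 ^ j" using assms by simp
    moreover have "0 < v" using assms(3) by (metis gr0I not_less power_not_zero zero_less_iff_neq_zero zero_neq_numeral)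
    ultimately show False using j by simp
  qed
  have eq: "(2 ^ L + h) div 2 ^ l = 2 ^ (L - l) + h div 2 ^ l" if "l \<le> L" for l
  proof -
    have "(2::nat) ^ L = 2 ^ (L - l) * 2 ^ l" using that by (simp flip: power_add)
    then show ?thesis by simp
  qed
  have "h div 2 ^ j < 2 ^ (L - j)"
    using assms(2) \<open>j \<le> L\<close> by (simp add: less_mult_imp_div_less flip: power_add)
  then have "2 ^ (L - j) \<le> v" "v < 2 ^ Suc (L - j)" using j eq[OF \<open>j \<le> L\<close>] by auto
  then have "(2::nat) ^ (L - j) < 2 ^ Suc i" "(2::nat) ^ i < 2 ^ Suc (L - j)" using assms(3,4) by linarith+
  then have "L - j = i" by (simp add: power_strict_increasing_iff del: power_Suc)
  then have "j = L - i" using \<open>j \<le> L\<close> by simp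
  then show ?thesis using j eq[of "L - i"] assms(1) by simp
qed

section \<open>The number of branching nodes, summed over all multipliers\<close>

lemma sum_two_sided_geometric:
  fixes c :: real assumes "0 \<le> c"
  shows "(\<Sum>i<n. if i < m then 2 ^ i else c / 2 ^ i) \<le> 2 ^ m + 2 * c / 2 ^ m"
proof -
  \<comment> \<open>The induction needs a stronger claim: the part of the second series still to
    come, \<open>2 * c / 2 ^ n\<close>, is subtracted.\<close>
  have "(\<Sum>i<n. if i < m then 2 ^ i else c / 2 ^ i) \<le> (if n \<le> m then 2 ^ n else 2 ^ m + 2 * c / 2 ^ m - 2 * c / 2 ^ n)"
  proof (induction n)
    case (Suc n)
    have "2 * c / 2 ^ n = c / 2 ^ n + 2 * c / 2 ^ Suc n" by simp
    then show ?case using Suc by (cases n m rule: linorder_cases) auto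
  qed simp
  also have "\<dots> \<le> 2 ^ m + 2 * c / 2 ^ m"
  proof (cases "n \<le> m")
    case True
    then have "(2::real) ^ n \<le> 2 ^ m" by simp
    moreover have "0 \<le> 2 * c / 2 ^ m" using assms by simp
    ultimately show ?thesis using True by (simp del: power_increasing_iff)
  qed (use assms in simp)
  finally show ?thesis .
qed

text \<open>Nodes of the search tree are numbered as in a binary heap: \<open>v\<close> has the children
  \<open>2 * v\<close> and \<open>2 * v + 1\<close>, and the leaves are \<open>N, \<dots>, 2 * N - 1\<close>.\<close>

definition colors_below :: "(nat \<Rightarrow> nat) \<Rightarrow> nat set \<Rightarrow> nat \<Rightarrow> nat set" where
  "colors_below leaf K v = {c \<in> K. anc v (leaf c)}"

definition branching :: "nat \<Rightarrow> (nat \<Rightarrow> nat) \<Rightarrow> nat set \<Rightarrow> nat \<Rightarrow> nat set" where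
  "branching N leaf K v = {u. u < 2 * N \<and> anc v u \<and> 2 \<le> card (colors_below leaf K u)}"

text \<open>Kept as a sum over all \<open>2 ^ m\<close> multipliers so that the counting needs no
  probability; division by \<open>2 ^ m\<close> gives an expectation of at most six times the number
  of colors.\<close>

lemma sum_branching:
  fixes L m :: nat and K :: "nat set" and f :: "nat \<Rightarrow> nat"
  assumes "finite K" and f: "inj_on f K" "f ` K \<subseteq> {1..2 ^ L}" and m: "L \<le> m + 1"
  shows "(\<Sum>x<2 ^ m. real (card (branching (2 ^ L) (\<lambda>c. 2 ^ L + hash (2 ^ L) x (f c)) K 1)))
     \<le> 6 * real (card K) * 2 ^ m"
proof (cases "K = {}")
  case True
  then show ?thesis by (simp add: branching_def colors_below_def)
next
  case False
  define k where "k = card K"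
  have k: "1 \<le> k" using False assms(1) by (simp add: k_def Suc_leI card_gt_0_iff)
  define leaf where "leaf x c = 2 ^ L + hash (2 ^ L) x (f c)" for x c
  define b where "b x i = {v. 2 ^ i \<le> v \<and> v < 2 ^ Suc i \<and> 2 \<le> card (colors_below (leaf x) K v)}" for x i
  have fin: "finite (b x i)" for x i by (rule finite_subset[of _ "{..<2 ^ Suc i}"]) (auto simp: b_def)
  define pairs where "pairs = {(c, d) \<in> K \<times> K. c \<noteq> d}"
  have fin_pairs: "finite pairs"
    by (rule finite_subset[of _ "K \<times> K"]) (auto simp: pairs_def assms(1))
  have card_pairs: "card pairs \<le> k * k"
    using card_mono[of "K \<times> K" pairs] assms(1) by (auto simp: pairs_def k_def card_cartesian_product)
  define coll where "coll x i = {(c, d) \<in> pairs.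
     hash (2 ^ L) x (f c) div 2 ^ (L - i) = hash (2 ^ L) x (f d) div 2 ^ (L - i)}" for x i
  have fin_coll: "finite (coll x i)" for x i
    by (rule finite_subset[OF _ fin_pairs]) (auto simp: coll_def)
  have total: "card (branching (2 ^ L) (leaf x) K 1) \<le> (\<Sum>i\<le>L. card (b x i))" for x
  proof -
    have "branching (2 ^ L) (leaf x) K 1 \<subseteq> (\<Union>i\<le>L. b x i)"
    proof
      fix v assume v: "v \<in> branching (2 ^ L) (leaf x) K 1"
      then have v': "v < 2 ^ Suc L" "1 \<le> v" "2 \<le> card (colors_below (leaf x) K v)"
        using anc_le by (auto simp: branching_def)
      then obtain i where i: "2 ^ i \<le> v" "v < 2 ^ Suc i"
        using ex_power_ivl1[of 2 v] by auto
      then have "(2::nat) ^ i < 2 ^ Suc L" using v' by linarith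
      then have "i \<le> L" by (simp del: power_Suc)
      then show "v \<in> (\<Union>i\<le>L. b x i)" using i v' by (auto simp: b_def)
    qed
    then have "card (branching (2 ^ L) (leaf x) K 1) \<le> card (\<Union>i\<le>L. b x i)"
      using fin by (intro card_mono) auto
    also have "\<dots> \<le> (\<Sum>i\<le>L. card (b x i))" by (rule card_UN_le) simp
    finally show ?thesis .
  qed
  have triv: "card (b x i) \<le> 2 ^ i" for x i
  proof -
    have "card (b x i) \<le> card {2 ^ i..<2 ^ Suc i :: nat}" by (rule card_mono) (auto simp: b_def)
    then show ?thesis by simp
  qed
  \<comment> \<open>A colliding pair is sent to the node of depth \<open>i\<close> on the path of
    its first color; every branching node of that depth arises in this way.\<close>
  have coll: "card (b x i) \<le> card (coll x i)" if "i \<le> L" for x i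
  proof (rule surj_card_le[OF fin_coll])
    show "b x i \<subseteq> (\<lambda>(c, d). 2 ^ i + hash (2 ^ L) x (f c) div 2 ^ (L - i)) ` coll x i"
    proof
      fix v assume v: "v \<in> b x i"
      then have "2 \<le> card (colors_below (leaf x) K v)" by (simp add: b_def)
      then obtain c d where cd: "c \<in> colors_below (leaf x) K v" "d \<in> colors_below (leaf x) K v" "c \<noteq> d"
        by (metis card_le_Suc0_iff_eq card.infinite not_less_eq_eq numeral_2_eq_2 zero_le)
      have "v = 2 ^ i + hash (2 ^ L) x (f c) div 2 ^ (L - i)" "v = 2 ^ i + hash (2 ^ L) x (f d) div 2 ^ (L - i)"
        using anc_level[OF that, of "hash (2 ^ L) x (f _)" v] hash_less[of "2 ^ L" x] v cd
        by (auto simp: b_def colors_below_def leaf_def)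
      then show "v \<in> (\<lambda>(c, d). 2 ^ i + hash (2 ^ L) x (f c) div 2 ^ (L - i)) ` coll x i"
        using cd by (intro image_eqI[of _ _ "(c, d)"]) (auto simp: coll_def pairs_def colors_below_def)
    qed
  qed
  have sum_coll: "(\<Sum>x<2 ^ m. real (card (coll x i))) \<le> 2 ^ m * (2 * real k ^ 2 / 2 ^ i)" if "i \<le> L" for i
  proof -
    define P where "P x p \<longleftrightarrow> hash (2 ^ L) x (f (fst p)) div 2 ^ (L - i) = hash (2 ^ L) x (f (snd p)) div 2 ^ (L - i)" for x p
    have "(\<Sum>x<2 ^ m. card (coll x i)) = (\<Sum>x<2 ^ m. \<Sum>p\<in>pairs. of_bool (P x p))"
    proof (rule sum.cong)
      fix x
      have "coll x i = pairs \<inter> {p. P x p}" by (auto simp: coll_def P_def)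
      then show "card (coll x i) = (\<Sum>p\<in>pairs. of_bool (P x p))"
        using fin_pairs by simp
    qed simp
    also have "\<dots> = (\<Sum>p\<in>pairs. card {x. x < 2 ^ m \<and> P x p})"
      by (subst sum.swap) (auto intro!: sum.cong arg_cong[of _ _ card])
    finally have "real (\<Sum>x<2 ^ m. card (coll x i)) = (\<Sum>p\<in>pairs. real (card {x. x < 2 ^ m \<and> P x p}))"
      by simp
    also have "\<dots> \<le> (\<Sum>p\<in>pairs. 2 * 2 ^ m / 2 ^ i)"
    proof (rule sum_mono)
      fix p assume "p \<in> pairs"
      then have "f (fst p) \<in> {1..2 ^ L}" "f (snd p) \<in> {1..2 ^ L}" "f (fst p) \<noteq> f (snd p)"
        using f by (auto simp: pairs_def inj_on_eq_iff)
      from card_hash_collisions[OF that m this]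
      have "card {x. x < 2 ^ m \<and> P x p} * 2 ^ i \<le> 2 * 2 ^ m" by (simp add: P_def)
      then have "real (card {x. x < 2 ^ m \<and> P x p} * 2 ^ i) \<le> real (2 * 2 ^ m)" by (simp only: of_nat_le_iff)
      then show "real (card {x. x < 2 ^ m \<and> P x p}) \<le> 2 * 2 ^ m / 2 ^ i" by (simp add: field_simps)
    qed
    also have "\<dots> = real (card pairs) * (2 * 2 ^ m / 2 ^ i)" by simp
    also have "\<dots> \<le> real (k * k) * (2 * 2 ^ m / 2 ^ i)"
      using card_pairs by (intro mult_right_mono) (simp_all only: of_nat_le_iff, simp)
    finally show ?thesis by (simp add: power2_eq_square mult_ac)
  qed
  \<comment> \<open>A power of two between \<open>k\<close> and \<open>2 * k\<close>;
    \<open>q\<close> is the depth at which the two level bounds change places.\<close>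
  obtain q where q: "2 ^ q \<le> 2 * k" "k \<le> 2 ^ q"
  proof -
    obtain i where "2 ^ i \<le> k" "k < 2 ^ Suc i" using ex_power_ivl1[of 2 k] k by auto
    then show ?thesis by (intro that[of "Suc i"]) auto
  qed
  have lev: "(\<Sum>x<2 ^ m. real (card (b x i))) \<le> 2 ^ m * (if i < q then 2 ^ i else 2 * real k ^ 2 / 2 ^ i)" if "i \<le> L" for i
  proof (cases "i < q")
    case True
    have "(\<Sum>x<2 ^ m. real (card (b x i))) \<le> (\<Sum>x<(2::nat) ^ m. 2 ^ i)"
    proof (rule sum_mono)
      fix x have "real (card (b x i)) \<le> real (2 ^ i)" using triv by (simp only: of_nat_le_iff)
      then show "real (card (b x i)) \<le> 2 ^ i" by simp
    qed
    then show ?thesis using True by simp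
  next
    case False
    have "(\<Sum>x<2 ^ m. real (card (b x i))) \<le> (\<Sum>x<2 ^ m. real (card (coll x i)))"
      using coll[OF that] by (intro sum_mono) simp
    then show ?thesis using sum_coll[OF that] False by simp
  qed
  have "(\<Sum>x<2 ^ m. real (card (branching (2 ^ L) (leaf x) K 1))) \<le> (\<Sum>x<2 ^ m. \<Sum>i\<le>L. real (card (b x i)))"
    using total by (intro sum_mono) (simp only: of_nat_le_iff flip: of_nat_sum)
  also have "\<dots> = (\<Sum>i\<le>L. \<Sum>x<2 ^ m. real (card (b x i)))" by (rule sum.swap)
  also have "\<dots> \<le> (\<Sum>i\<le>L. 2 ^ m * (if i < q then 2 ^ i else 2 * real k ^ 2 / 2 ^ i))"
    using lev by (intro sum_mono) simp
  also have "\<dots> = 2 ^ m * (\<Sum>i<Suc L. if i < q then 2 ^ i else 2 * real k ^ 2 / 2 ^ i)"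
    by (simp only: sum_distrib_left lessThan_Suc_atMost)
  also have "\<dots> \<le> 2 ^ m * (2 ^ q + 2 * (2 * real k ^ 2) / 2 ^ q)"
    by (intro mult_left_mono sum_two_sided_geometric) auto
  \<comment> \<open>The part \<open>2 * k\<close> comes from the depths before the crossover, by
    \<open>2 ^ q \<le> 2 * k\<close>; the part \<open>4 * k\<close> from the depths after it, by
    \<open>k \<le> 2 ^ q\<close>.\<close>
  also have "\<dots> \<le> 2 ^ m * (2 * real k + 4 * real k)"
  proof -
    have "real (2 ^ q) \<le> real (2 * k)" "real k \<le> real (2 ^ q)" using q by (simp_all only: of_nat_le_iff)
    then have q': "(2::real) ^ q \<le> 2 * k" "real k \<le> 2 ^ q" by simp_all
    have "real k * real k \<le> real k * 2 ^ q" using q' by (intro mult_left_mono) auto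
    then have "2 * (2 * real k ^ 2) / 2 ^ q \<le> 4 * real k"
      by (simp add: field_simps power2_eq_square)
    then show ?thesis using q' by (intro mult_left_mono) auto
  qed
  finally show ?thesis unfolding leaf_def k_def by (simp add: algebra_simps)
qed

lemma colors_below_split:
  assumes "\<And>c. c \<in> K \<Longrightarrow> leaf c \<noteq> v"
  shows "colors_below leaf K v = colors_below leaf K (2 * v) \<union> colors_below leaf K (2 * v + 1)"
  using assms by (auto simp: colors_below_def anc_iff_children[of v])

lemma colors_below_disjoint:
  "1 \<le> v \<Longrightarrow> colors_below leaf K (2 * v) \<inter> colors_below leaf K (2 * v + 1) = {}"
  using anc_children_disjoint[of v] by (auto simp: colors_below_def)

lemma finite_branching [simp]: "finite (branching N leaf K v)"
  by (rule finite_subset[of _ "{..<2 * N}"]) (auto simp: branching_def)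

text \<open>This recurrence drives the accounting of the query: the potential of a node pays for its
  own visit and splits over the two children.\<close>

lemma card_branching:
  assumes "1 \<le> v" "v < 2 * N" "2 \<le> card (colors_below leaf K v)"
  shows "card (branching N leaf K v) = 1 + card (branching N leaf K (2 * v)) + card (branching N leaf K (2 * v + 1))"
proof -
  have "branching N leaf K v = insert v (branching N leaf K (2 * v) \<union> branching N leaf K (2 * v + 1))"
    using assms by (auto simp: branching_def anc_iff_children[of v])
  moreover have "v \<notin> branching N leaf K (2 * v) \<union> branching N leaf K (2 * v + 1)"
    using assms(1) by (auto simp: branching_def dest!: anc_le)
  moreover have "branching N leaf K (2 * v) \<inter> branching N leaf K (2 * v + 1) = {}"
    using anc_children_disjoint[OF assms(1)] by (auto simp: branching_def)
  ultimately show ?thesis by (simp add: card_Un_disjoint)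
qed

section \<open>Preprocessing\<close>

abbreviation bool_val :: "bool \<Rightarrow> 'a val" where "bool_val b \<equiv> Scalar (Word (of_bool b))"

text \<open>The number travels with the point, since the table of numbers lives in the private
  memory of the subprogram that computes it.\<close>

definition item_val :: "(nat \<Rightarrow> nat) \<Rightarrow> 'a \<times> nat \<Rightarrow> 'a val" where
  "item_val f p = Arr [point_val p, Scalar (Word (f (snd p)))]"

text \<open>Memory serves as a table indexed by colors; each color is numbered by the position of its
  first occurrence, counted from 1.\<close>

definition tag_loop :: "'o com" where
  "tag_loop = Index 6 0 2 ;; Index 7 6 3 ;; Load 8 7 ;; Arith 2 Add 2 3 ;;
     If 8 (Const 9 0) (Store 7 2 ;; Move 8 2) ;;
     Call 6 cons_com [6, 8] ;; Call 4 cons_com [6, 4] ;; Arith 5 Less 2 1"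

definition tag_com :: "'o com" where
  "tag_com = Length 1 0 ;; Const 3 1 ;; Arith 5 Less 2 1 ;; While 5 tag_loop ;; Move 0 4"

text \<open>The actual numbers depend on the order of the input; the analysis uses only distinctness
  and a range that fits into \<open>{1..2 ^ L}\<close>. The number 0 is excluded because untouched
  memory reads 0.\<close>

definition numbering :: "('a \<times> nat) list \<Rightarrow> (nat \<Rightarrow> nat) \<Rightarrow> bool" where
  "numbering xs f \<longleftrightarrow> inj_on f (snd ` set xs) \<and> f ` snd ` set xs \<subseteq> {1..length xs}"

lemma of_bool_mod [simp]: "(1::nat) < m \<Longrightarrow> of_bool b mod m = of_bool b"
  by (cases b) auto

lemma run_tag:
  fixes xs :: "('a \<times> nat) list"
  assumes w: "length xs < 2 ^ w" "2 \<le> w"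
  shows "runs_in (run w prim tag_com [Arr (map point_val xs)]) (30 * real (length xs) + 5)
    (\<lambda>v. \<exists>f. numbering xs f \<and> v = list_val (rev (map (item_val f) xs)))"
proof -
  have w1: "(1::nat) < 2 ^ w" using one_less_power[of "2::nat" w] w(2) by simp
  have w0: "0 < w" using w(2) by simp
  define n where "n = length xs"
  \<comment> \<open>The ghost \<open>f\<close> is the memory table itself. Each nonzero entry leads
    to a position holding that color, which recovers the color from its number and so yields
    injectivity.\<close>
  define I where "I g s = (case g of (i, f) \<Rightarrow> case s of (R, M) \<Rightarrow> i \<le> n \<and>
     R 0 = Arr (map point_val xs) \<and> R 1 = Scalar (Word n) \<and> R 2 = Scalar (Word i) \<and>
     R 3 = Scalar (Word 1) \<and> R 4 = list_val (rev (map (item_val f) (take i xs))) \<and>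
     R 5 = bool_val (i < n) \<and> M = (\<lambda>c. Scalar (Word (f c))) \<and>
     (\<forall>c. f c \<noteq> 0 \<longrightarrow> f c \<le> i \<and> snd (xs ! (f c - 1)) = c) \<and> (\<forall>p \<in> set (take i xs). f (snd p) \<noteq> 0))"
    for g and s :: "'a state"
  define \<phi> where "\<phi> g = 30 * real (n - fst g) + 1" for g :: "nat \<times> (nat \<Rightarrow> nat)"
  show ?thesis unfolding tag_com_def
  proof (intro runs_in_run runs_in_instr, rule runs_in_Seq_While[where I = I and g = "(0, \<lambda>_. 0)" and \<phi> = \<phi>])
    fix g R M assume I: "I g (R, M)" and 5: "R 5 \<noteq> zero_val"
    obtain i f where g: "g = (i, f)" by (cases g)
    have i: "i < n" using I 5 by (auto simp: I_def g)
    define p where "p = xs ! i"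
    define f' where "f' = (if f (snd p) = 0 then f(snd p := Suc i) else f)"
    have f: "\<And>c. f c \<noteq> 0 \<Longrightarrow> f c \<le> i \<and> snd (xs ! (f c - 1)) = c" "\<And>p. p \<in> set (take i xs) \<Longrightarrow> f (snd p) \<noteq> 0"
      using I by (auto simp: I_def g)
    have take: "take (Suc i) xs = take i xs @ [p]"
      using i by (simp add: p_def n_def take_Suc_conv_app_nth)
    have f': "f' c \<noteq> 0 \<Longrightarrow> f' c \<le> Suc i \<and> snd (xs ! (f' c - 1)) = c" for c
      using f(1)[of c] by (auto simp: f'_def p_def)
    have f'_nz: "f' (snd q) \<noteq> 0" if "q \<in> set (take (Suc i) xs)" for q
      using f(2)[of q] that by (auto simp: f'_def take)
    \<comment> \<open>An entry once nonzero is never overwritten, so the items emitted so far stay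
      valid for the new table.\<close>
    have eq: "f' (snd q) = f (snd q)" if "q \<in> set (take i xs)" for q
      using f(2)[OF that] by (auto simp: f'_def)
    have items: "map (item_val f') (take (Suc i) xs) = map (item_val f) (take i xs) @ [item_val f' p]"
      using eq by (auto simp: take item_val_def)
    have wi: "Suc i < 2 ^ w" using i w by (simp add: n_def)
    define Q where "Q s' \<longleftrightarrow> (\<exists>g'. I g' s' \<and> 29 + 1 + \<phi> g' \<le> \<phi> g)" for s'
    have Suc_i: "30 * real (n - i) = 30 + 30 * real (n - Suc i)" using i by (simp add: of_nat_diff)
    have fin: "Q (R', M')"
      if "R' 0 = R 0" "R' 1 = R 1" "R' 2 = Scalar (Word (Suc i))" "R' 3 = R 3"
        "R' 4 = Arr [item_val f' p, R 4]" "R' 5 = bool_val (Suc i < n)" "M' = (\<lambda>c. Scalar (Word (f' c)))" for R' M'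
      using that I i f' f'_nz items Suc_i
      unfolding Q_def by (intro exI[of _ "(Suc i, f')"]) (auto simp: I_def \<phi>_def g)
    have R: "R 0 = Arr (map point_val xs)" "R (Suc 0) = Scalar (Word n)" "R 2 = Scalar (Word i)"
      "R 3 = Scalar (Word 1)" "M = (\<lambda>c. Scalar (Word (f c)))"
      using I by (auto simp: I_def g)
    have point: "map point_val xs ! i = point_val p" "i < length xs" using i by (auto simp: p_def n_def)
    have "runs_in (exec w prim tag_loop (R, M)) 29 Q"
      unfolding tag_loop_def
      by (intro runs_in_instr runs_in_Seq_If runs_in_Seq_Seq runs_in_cons w)
         (auto simp: R point point_val_def item_val_def f'_def wi w0 intro!: fin)
    then have "runs_in (exec w prim tag_loop (R, M)) 29 (\<lambda>s'. \<exists>g'. I g' s' \<and> 29 + 1 + \<phi> g' \<le> \<phi> g)"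
      by (simp only: Q_def[abs_def])
    then show "\<exists>T. runs_in (exec w prim tag_loop (R, M)) T (\<lambda>s'. \<exists>g'. I g' s' \<and> T + 1 + \<phi> g' \<le> \<phi> g)"
      by blast
  next
    fix g R M assume I: "I g (R, M)" and 5: "R 5 = zero_val"
    then obtain f where g: "g = (n, f)" by (cases g) (auto simp: I_def)
    have f: "\<And>c. f c \<noteq> 0 \<Longrightarrow> f c \<le> n \<and> snd (xs ! (f c - 1)) = c" "\<And>p. p \<in> set xs \<Longrightarrow> f (snd p) \<noteq> 0"
      using I by (auto simp: I_def g n_def)
    have "inj_on f (snd ` set xs)"
      by (rule inj_onI) (metis f imageE)
    moreover have "f ` snd ` set xs \<subseteq> {1..n}" using f by (auto simp: Suc_le_eq)
    ultimately show "runs_in (exec w prim (Move 0 4) (R, M)) (30 * real (length xs) + 5 - 1 - 1 - 1 - \<phi> (0, \<lambda>_. 0))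
       (\<lambda>(R, M). \<exists>f. numbering xs f \<and> R 0 = list_val (rev (map (item_val f) xs)))"
      using I by (auto simp: I_def g n_def \<phi>_def numbering_def)
  qed (use w w1 in \<open>auto simp: I_def \<phi>_def n_def\<close>)
qed

section \<open>Distributing the points over the paths to the root\<close>

definition path_loop :: "'o com" where
  "path_loop = Load 7 9 ;; Call 7 cons_com [6, 7] ;; Store 9 7 ;; Arith 9 Div 9 4"

lemma run_path:
  assumes w: "2 \<le> w" and R: "R 4 = Scalar (Word 2)" "R 9 = Scalar (Word u)" and u: "u < 2 ^ l" "u < 2 ^ w"
  shows "runs_in (exec w prim (While 9 path_loop) (R, M)) (13 * real l + 1)
    (\<lambda>(R', M'). (\<forall>i. i \<noteq> 7 \<and> i \<noteq> 9 \<longrightarrow> R' i = R i) \<and>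
       M' = (\<lambda>v. if 1 \<le> v \<and> anc v u then Arr [R 6, M v] else M v))"
proof -
  \<comment> \<open>The cells already extended belong to the ancestors of \<open>u\<close> that are
    not ancestors of the current node \<open>t\<close>. The loop ends with \<open>t = 0\<close>,
    which has no positive ancestor, so then all of them are done.\<close>
  define I where "I g s = (case g of (t, k) \<Rightarrow> case s of (R', M') \<Rightarrow> t < 2 ^ k \<and> t < 2 ^ w \<and> anc t u \<and>
     (\<forall>i. i \<noteq> 7 \<and> i \<noteq> 9 \<longrightarrow> R' i = R i) \<and> R' 9 = Scalar (Word t) \<and>
     M' = (\<lambda>v. if 1 \<le> v \<and> anc v u \<and> \<not> anc v t then Arr [R 6, M v] else M v))"
    for g and s :: "'a state"
  define \<phi> where "\<phi> g = 13 * real (snd g) + 1" for g :: "nat \<times> nat"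
  have "runs_in (exec w prim (While 9 path_loop) (R, M)) (\<phi> (u, l)) (\<lambda>s'. \<exists>g'. I g' s' \<and> fst s' 9 = zero_val)"
  proof (rule runs_in_While)
    fix g R' M' assume I: "I g (R', M')" and 9: "R' 9 \<noteq> zero_val"
    obtain t k where g: "g = (t, k)" by (cases g)
    have t: "1 \<le> t" "t < 2 ^ k" "t < 2 ^ w" "anc t u" and R': "\<And>i. i \<noteq> 7 \<and> i \<noteq> 9 \<Longrightarrow> R' i = R i" "R' 9 = Scalar (Word t)"
      and M': "M' = (\<lambda>v. if 1 \<le> v \<and> anc v u \<and> \<not> anc v t then Arr [R 6, M v] else M v)"
      using I 9 by (auto simp: I_def g)
    obtain k' where k: "k = Suc k'" using t by (cases k) auto
    have half: "t div 2 < 2 ^ k'" "t div 2 < 2 ^ w" using t by (auto simp: k)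
    have "\<not> anc t (t div 2)" using anc_le[of t "t div 2"] t by auto
    then have M'': "M'(t := Arr [R 6, M t]) = (\<lambda>v. if 1 \<le> v \<and> anc v u \<and> \<not> anc v (t div 2) then Arr [R 6, M v] else M v)"
      using t anc_iff_half[of _ t] by (auto simp: M' fun_eq_iff)
    have Mt: "M' t = M t" by (simp add: M')
    have "I (t div 2, k') (R'', M'(t := Arr [R 6, M t]))"
      if "R'' 9 = Scalar (Word (t div 2))" "\<And>i. i \<noteq> 7 \<and> i \<noteq> 9 \<Longrightarrow> R'' i = R i" for R''
      using that half anc_half[OF t(4)] by (simp add: I_def M'')
    then have "runs_in (exec w prim path_loop (R', M')) 12 (\<lambda>s'. I (t div 2, k') s')"
      unfolding path_loop_def using w R half
      by (intro runs_in_instr runs_in_cons w) (simp add: R' Mt)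
    then show "\<exists>T. runs_in (exec w prim path_loop (R', M')) T (\<lambda>s'. \<exists>g'. I g' s' \<and> T + 1 + \<phi> g' \<le> \<phi> g)"
      by (intro exI[of _ 12], elim runs_in_weaken) (auto simp: \<phi>_def g k simp del: split_paired_Ex intro!: exI[of _ "(t div 2, k')"])
  qed (use u R in \<open>auto simp: I_def \<phi>_def\<close>)
  moreover have "\<not> anc v 0" if "1 \<le> v" for v using anc_le[of v 0] that by auto
  ultimately show ?thesis
    by (elim runs_in_weaken) (auto simp: I_def \<phi>_def fun_eq_iff)
qed

text \<open>Without a remainder instruction, the residue of the product \<open>t\<close> is computed
  as \<open>t - t div N * N\<close>; adding \<open>N\<close> turns the rank into the heap index of a
  leaf.\<close>

definition insert_loop :: "'o com" where
  "insert_loop = Index 6 2 10 ;; Index 2 2 3 ;; Index 9 6 3 ;; Index 6 6 10 ;; Arith 9 Mul 9 8 ;;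
     Arith 11 Div 9 5 ;; Arith 11 Mul 11 5 ;; Arith 9 Sub 9 11 ;; Arith 9 Add 5 9 ;; While 9 path_loop"

text \<open>Being a filter of \<open>xs\<close>, the list inherits admissibility, so the given
  builder applies at every node.\<close>

definition node_points :: "nat \<Rightarrow> nat \<Rightarrow> (nat \<Rightarrow> nat) \<Rightarrow> ('a \<times> nat) list \<Rightarrow> nat \<Rightarrow> ('a \<times> nat) list" where
  "node_points N x f xs v = filter (\<lambda>p. anc v (N + hash N x (f (snd p)))) xs"

lemma node_points_simps:
  "node_points N x f [] v = []"
  "node_points N x f (p # ys) v =
     (if anc v (N + hash N x (f (snd p))) then p # node_points N x f ys v else node_points N x f ys v)"
  "rev (node_points N x f ys v) = node_points N x f (rev ys) v"
  by (auto simp: node_points_def rev_filter)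

text \<open>Consing reverses the lists, but tagging has already reversed the input: for
  \<open>ys = rev xs\<close> the two reversals cancel.\<close>

lemma run_insert:
  fixes ys :: "('a \<times> nat) list"
  assumes w: "2 \<le> w" and N: "N = 2 ^ L" "2 * N < 2 ^ w" and x: "2 * x + 1 < 2 ^ w"
    and R: "R 2 = list_val (map (item_val f) ys)" "R 3 = Scalar (Word 1)" "R 4 = Scalar (Word 2)"
      "R 5 = Scalar (Word N)" "R 8 = Scalar (Word (2 * x + 1))" "R 10 = zero_val"
  shows "runs_in (exec w prim (While 2 insert_loop) (R, \<lambda>_. zero_val)) ((13 * real L + 24) * real (length ys) + 1)
    (\<lambda>(R', M'). (\<forall>i\<in>{3,4,5,10}. R' i = R i) \<and> M' 0 = zero_val \<and>
       (\<forall>v\<ge>1. M' v = list_val (map point_val (rev (node_points N x f ys v)))))"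
proof -
  define I where "I g s = (case g of (done, rest) \<Rightarrow> case s of (R', M') \<Rightarrow> ys = done @ rest \<and>
      R' 2 = list_val (map (item_val f) rest) \<and> (\<forall>i\<in>{3,4,5,8,10}. R' i = R i) \<and> M' 0 = zero_val \<and>
      (\<forall>v\<ge>1. M' v = list_val (map point_val (rev (node_points N x f done v)))))"
    for g and s :: "'a state"
  \<comment> \<open>Per item: 9 instructions, \<open>13 * (L + 1) + 1\<close> for a path of
    \<open>L + 1\<close> nodes, and 1 for the loop test.\<close>
  define \<phi> where "\<phi> g = (13 * real L + 24) * real (length (snd g)) + 1" for g :: "('a \<times> nat) list \<times> ('a \<times> nat) list"
  have "runs_in (exec w prim (While 2 insert_loop) (R, \<lambda>_. zero_val)) (\<phi> ([], ys)) (\<lambda>s'. \<exists>g'. I g' s' \<and> fst s' 2 = zero_val)"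
  proof (rule runs_in_While)
    fix g R' M' assume I: "I g (R', M')" and 2: "R' 2 \<noteq> zero_val"
    obtain "done" rest' where g': "g = (done, rest')" by (cases g)
    with I 2 obtain p rest where rest': "rest' = p # rest" by (cases rest') (auto simp: I_def)
    note g = g'[unfolded rest']
    have R': "R' 2 = Arr [item_val f p, list_val (map (item_val f) rest)]" "R' 3 = Scalar (Word 1)"
        "R' 4 = Scalar (Word 2)" "R' 5 = Scalar (Word N)" "R' 8 = Scalar (Word (2 * x + 1))" "R' 10 = zero_val"
      using I R by (auto simp: I_def g)
    define a where "a = 2 * x + 1"
    note R'' = R'[folded a_def]
    define u where "u = N + hash N x (f (snd p))"
    have "hash N x (f (snd p)) < N" using N(1) by (simp add: hash_less)
    then have u: "u < 2 ^ Suc L" "u < 2 ^ w" using N by (auto simp: u_def)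
    define t where "t = f (snd p) * a mod 2 ^ w"
    have tN: "t mod N = hash N x (f (snd p))"
    proof -
      have "(2::nat) ^ Suc L < 2 ^ w" using N by simp
      then have "L \<le> w" by (simp del: power_Suc)
      then have "N dvd 2 ^ w" using N(1) by (simp add: le_imp_power_dvd)
      then show ?thesis by (simp add: t_def a_def hash_def mod_mod_cancel mult.commute)
    qed
    have t: "t < 2 ^ w" "t div N < 2 ^ w" "t div N * N < 2 ^ w" "t div N * N \<le> t"
      by (auto simp: t_def div_times_less_eq_dividend intro: le_less_trans[OF div_le_dividend] le_less_trans[OF div_times_less_eq_dividend])
    have sub: "(t + (2 ^ w - t div N * N)) mod 2 ^ w = t mod N"
    proof -
      have "t + (2 ^ w - t div N * N) = t mod N + 2 ^ w"
        using t div_mult_mod_eq[of t N] by linarith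
      moreover have "t mod N < 2 ^ w" using t(1) by (meson le_less_trans mod_less_eq_dividend)
      ultimately show ?thesis by simp
    qed
    let ?Q = "\<lambda>(R'', M''). (\<forall>i. i \<notin> {2,6,7,9,11} \<longrightarrow> R'' i = R' i) \<and> R'' 2 = list_val (map (item_val f) rest) \<and>
        M'' = (\<lambda>v. if 1 \<le> v \<and> anc v u then Arr [point_val p, M' v] else M' v)"
    have "runs_in (exec w prim insert_loop (R', M')) (13 * real L + 23) ?Q"
      unfolding insert_loop_def
      by ((rule runs_in_instr, simp add: R'' item_val_def sub tN t t_def[symmetric] u_def[symmetric] u(2) del: exec.simps)+,
          rule runs_in_weaken[OF run_path[OF w, where u = u and l = "Suc L"]])
         (use u in \<open>auto simp: R''\<close>)
    moreover have "I (done @ [p], rest) s'" if "?Q s'" for s'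
      using that I by (auto simp: I_def g node_points_simps u_def[symmetric])
    ultimately show "\<exists>T. runs_in (exec w prim insert_loop (R', M')) T (\<lambda>s'. \<exists>g'. I g' s' \<and> T + 1 + \<phi> g' \<le> \<phi> g)"
      by (intro exI[of _ "13 * real L + 23"], elim runs_in_weaken)
        (auto simp: \<phi>_def g algebra_simps simp del: split_paired_Ex intro!: exI[of _ "(done @ [p], rest)"])
  qed (use R in \<open>auto simp: I_def \<phi>_def node_points_simps\<close>)
  then show ?thesis
    by (rule runs_in_weaken) (auto simp: I_def \<phi>_def)
qed

section \<open>Building the structures of all nodes\<close>

definition node_loop :: "'o com \<Rightarrow> 'o com" where
  "node_loop build = Load 7 9 ;; Call 7 to_array_com [7] ;; Call 7 build [7] ;; Store 9 7 ;;
     Arith 9 Add 9 3 ;; Arith 6 Less 9 5"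

text \<open>Cell \<open>v\<close> holds a list until its turn comes and a structure afterwards, so
  one table serves both purposes. The builder runs under \<open>Call\<close> and cannot disturb it.
  The potential is the sum of the expected costs still ahead.\<close>

lemma run_nodes:
  fixes pts :: "nat \<Rightarrow> ('a \<times> nat) list"
  assumes w: "2 \<le> w" "2 * N < 2 ^ w" "1 \<le> N"
    and R: "R 3 = Scalar (Word 1)" "R 5 = Scalar (Word (2 * N))" "R 6 = Scalar (Word 1)"
      "R 9 = Scalar (Word 1)" "R 10 = zero_val"
    and M: "M 0 = zero_val" "\<And>v. 1 \<le> v \<Longrightarrow> M v = list_val (map point_val (pts v))"
    and pts: "\<And>v. length (pts v) < 2 ^ w"
    and build: "\<And>v. runs_in (run w prim build [Arr (map point_val (pts v))]) (P (length (pts v))) (G (pts v))"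
  shows "runs_in (exec w prim (While 6 (node_loop build) ;; Freeze 0 10 5) (R, M))
     ((\<Sum>v=1..<2 * N. P (length (pts v)) + 6 * real (length (pts v)) + 10) + 2 * real N + 2)
     (\<lambda>(R, M). \<exists>ds. R 0 = Arr ds \<and> length ds = 2 * N \<and> ds ! 0 = zero_val \<and> (\<forall>v\<in>{1..<2 * N}. G (pts v) (ds ! v)))"
proof -
  define cost where "cost v = P (length (pts v)) + 6 * real (length (pts v)) + 10" for v
  have cost: "0 \<le> cost v" for v
    using build[of v] by (auto simp: cost_def runs_in_iff)
  define \<phi> where "\<phi> v = (\<Sum>v=v..<2 * N. cost v) + 1" for v
  define I where "I v s = (case s of (R', M') \<Rightarrow> 1 \<le> v \<and> v \<le> 2 * N \<and> R' 3 = Scalar (Word 1) \<and> R' 5 = Scalar (Word (2 * N)) \<and>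
     R' 6 = bool_val (v < 2 * N) \<and> R' 9 = Scalar (Word v) \<and> R' 10 = zero_val \<and> M' 0 = zero_val \<and>
     (\<forall>u. 1 \<le> u \<and> u < v \<longrightarrow> G (pts u) (M' u)) \<and> (\<forall>u\<ge>v. M' u = M u))" for v and s :: "'a state"
  show ?thesis
  proof (rule runs_in_Seq_While[where I = I and g = 1 and \<phi> = \<phi>])
    fix v R' M' assume I: "I v (R', M')" and "R' 6 \<noteq> zero_val"
    then have v: "v < 2 * N" "1 \<le> v" by (auto simp: I_def)
    have wv: "Suc v < 2 ^ w" using v w by simp
    have R': "R' 3 = Scalar (Word 1)" "R' 5 = Scalar (Word (2 * N))" "R' 9 = Scalar (Word v)" "R' 10 = zero_val"
      and Mv: "M' v = list_val (map point_val (pts v))" and "M' 0 = zero_val"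
      and M': "\<And>u. 1 \<le> u \<Longrightarrow> u < v \<Longrightarrow> G (pts u) (M' u)" "\<And>u. v \<le> u \<Longrightarrow> M' u = M u"
      using I M(2) v by (auto simp: I_def)
    have "runs_in (exec w prim (node_loop build) (R', M')) (cost v - 1) (I (Suc v))"
      unfolding node_loop_def
    proof (intro runs_in_instr)
      show "runs_in (exec w prim (Call 7 to_array_com [7] ;; Call 7 build [7] ;; Store 9 7 ;; Arith 9 Add 9 3 ;; Arith 6 Less 9 5)
         (R'(7 := M' (word_of (R' 9))), M')) (cost v - 1 - 1) (I (Suc v))"
      proof (rule runs_in_Seq_Call)
        show "runs_in (run w prim to_array_com (map (R'(7 := M' (word_of (R' 9)))) [7]))
           (6 * real (length (map point_val (pts v))) + 3) (\<lambda>x. x = Arr (map point_val (pts v)))"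
          using run_to_array[of "map point_val (pts v)" w prim] pts w by (simp add: R' Mv)
      next
        fix a assume a: "a = Arr (map point_val (pts v))"
        show "runs_in (exec w prim (Call 7 build [7] ;; Store 9 7 ;; Arith 9 Add 9 3 ;; Arith 6 Less 9 5)
           (R'(7 := M' (word_of (R' 9)), 7 := a), M')) (cost v - 1 - 1 - (6 * real (length (map point_val (pts v))) + 3) - 1) (I (Suc v))"
        proof (rule runs_in_Seq_Call)
          show "runs_in (run w prim build (map (R'(7 := M' (word_of (R' 9)), 7 := a)) [7])) (P (length (pts v))) (G (pts v))"
            using build[of v] by (simp add: a)
        next
          fix d assume "G (pts v) d"
          then have "I (Suc v) (R'', M'(v := d))" if "R'' 3 = Scalar (Word 1)" "R'' 5 = Scalar (Word (2 * N))"
              "R'' 6 = bool_val (Suc v < 2 * N)" "R'' 9 = Scalar (Word (Suc v))" "R'' 10 = zero_val" for R''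
            using that v M' \<open>M' 0 = zero_val\<close> by (auto simp: I_def less_Suc_eq)
          then show "runs_in (exec w prim (Store 9 7 ;; Arith 9 Add 9 3 ;; Arith 6 Less 9 5)
            (R'(7 := M' (word_of (R' 9)), 7 := a, 7 := d), M')) (cost v - 1 - 1 - (6 * real (length (map point_val (pts v))) + 3) - 1 - P (length (pts v)) - 1) (I (Suc v))"
            using w wv by (intro runs_in_instr) (simp add: R' cost_def)
        qed
      qed
    qed
    moreover have "\<phi> v = cost v + \<phi> (Suc v)"
      using v by (simp add: \<phi>_def sum.atLeast_Suc_lessThan)
    ultimately show "\<exists>T. runs_in (exec w prim (node_loop build) (R', M')) T (\<lambda>s'. \<exists>g'. I g' s' \<and> T + 1 + \<phi> g' \<le> \<phi> v)"
      by (intro exI[of _ "cost v - 1"], elim runs_in_weaken) auto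
  next
    fix v R' M' assume I: "I v (R', M')" and "R' 6 = zero_val"
    then have v: "v = 2 * N" by (auto simp: I_def)
    show "runs_in (exec w prim (Freeze 0 10 5) (R', M'))
      ((\<Sum>v=1..<2 * N. P (length (pts v)) + 6 * real (length (pts v)) + 10) + 2 * real N + 2 - \<phi> 1)
      (\<lambda>(R, M). \<exists>ds. R 0 = Arr ds \<and> length ds = 2 * N \<and> ds ! 0 = zero_val \<and> (\<forall>v\<in>{1..<2 * N}. G (pts v) (ds ! v)))"
      using I w by (auto simp: I_def v Let_def \<phi>_def cost_def)
  qed (use R w M in \<open>auto simp: I_def \<phi>_def intro!: sum_nonneg cost\<close>)
qed

text \<open>Slot 0 pads the array so that heap numbers serve directly as indices; its content is
  fixed because it counts towards \<open>vsize\<close>.\<close>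

definition tree_for :: "(('a \<times> nat) list \<Rightarrow> 'a val \<Rightarrow> bool) \<Rightarrow> nat \<Rightarrow> nat \<Rightarrow> (nat \<Rightarrow> nat) \<Rightarrow> ('a \<times> nat) list \<Rightarrow> 'a val \<Rightarrow> bool" where
  "tree_for G N x f xs d \<longleftrightarrow> (\<exists>ds. d = Arr ds \<and> length ds = 2 * N \<and> ds ! 0 = zero_val \<and>
     (\<forall>v\<in>{1..<2 * N}. G (node_points N x f xs v) (ds ! v)))"

definition tree_com :: "'o com \<Rightarrow> 'o com" where
  "tree_com build = Arith 8 Add 8 8 ;; Arith 8 Add 8 3 ;; While 2 insert_loop ;; Move 9 3 ;;
     Arith 5 Add 5 5 ;; Arith 6 Less 9 5 ;; While 6 (node_loop build) ;; Freeze 0 10 5"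

text \<open>The disjunction bounds \<open>2 ^ L\<close> from above: doubling stops once
  \<open>length xs\<close> is reached, and \<open>L = 0\<close> covers inputs of at most one
  point.\<close>

definition prepared :: "nat \<Rightarrow> ('a \<times> nat) list \<Rightarrow> nat \<Rightarrow> (nat \<Rightarrow> nat) \<Rightarrow> 'a state \<Rightarrow> bool" where
  "prepared w xs L f = (\<lambda>(R, M). numbering xs f \<and> length xs \<le> 2 ^ L \<and> (L = 0 \<or> 2 ^ L < 2 * length xs) \<and>
     R 2 = list_val (map (item_val f) (rev xs)) \<and> R 3 = Scalar (Word 1) \<and> R 4 = Scalar (Word 2) \<and>
     R 5 = Scalar (Word (2 ^ L)) \<and> R 7 = Scalar (Word (2 ^ (w - 1))) \<and> R 10 = zero_val \<and> M = (\<lambda>_. zero_val))"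

text \<open>Stated for each fixed multiplier \<open>x\<close>, which separates the randomness of the
  builders from that of the hashing.\<close>

lemma run_tree:
  fixes xs :: "('a \<times> nat) list"
  assumes w: "2 \<le> w" "4 * length xs + 4 < 2 ^ w" and x: "x < 2 ^ (w - 1)"
    and prep: "prepared w xs L f (R, M)" and R8: "R 8 = Scalar (Word x)"
    and build: "\<And>Q. runs_in (run w prim build [Arr (map point_val (filter Q xs))])
      (P (length (filter Q xs))) (G (filter Q xs))"
  shows "runs_in (exec w prim (tree_com build) (R, M))
     ((13 * real L + 24) * real (length xs) + 2 * 2 ^ L + 8 +
      (\<Sum>v=1..<2 * 2 ^ L. P (length (node_points (2 ^ L) x f xs v)) + 6 * real (length (node_points (2 ^ L) x f xs v)) + 10))
     (\<lambda>(R, M). tree_for G (2 ^ L) x f xs (R 0))"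
proof -
  define N where "N = (2::nat) ^ L"
  have N: "2 * N < 2 ^ w" "1 \<le> N"
    using prep w by (auto simp: prepared_def N_def)
  have "(2::nat) ^ w = 2 * 2 ^ (w - 1)" using w(1) by (cases w) auto
  then have x': "2 * x + 1 < 2 ^ w" using x by linarith
  have R: "R 2 = list_val (map (item_val f) (rev xs))" "R 3 = Scalar (Word 1)" "R 4 = Scalar (Word 2)"
      "R 5 = Scalar (Word N)" "R 10 = zero_val" "M = (\<lambda>_. zero_val)"
    using prep by (auto simp: prepared_def N_def)
  define a where "a = 2 * x + 1"
  let ?R = "R(8 := Scalar (Word a))"
  let ?pts = "node_points N x f xs"
  have x2: "x + x < 2 ^ w" "(x + x + Suc 0) mod 2 ^ w = a" using x' by (auto simp: a_def mult_2)
  let ?T = "(13 * real L + 24) * real (length (rev xs)) + 1"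
  define B where "B = (\<Sum>v=1..<2 * N. P (length (?pts v)) + 6 * real (length (?pts v)) + 10) + 2 * real N + 2"
  have ins: "runs_in (exec w prim (While 2 insert_loop) (?R, M)) ?T
    (\<lambda>(R', M'). (\<forall>i\<in>{3,4,5,10}. R' i = ?R i) \<and> M' 0 = zero_val \<and>
       (\<forall>v\<ge>1. M' v = list_val (map point_val (rev (node_points N x f (rev xs) v)))))"
    unfolding R(6) by (rule run_insert[OF w(1) N_def N(1) x']) (simp_all add: R a_def)
  have len: "length (?pts v) < 2 ^ w" for v
  proof -
    have "length (?pts v) \<le> length xs" by (simp add: node_points_def)
    then show ?thesis using w(2) by linarith
  qed
  have bld: "runs_in (run w prim build [Arr (map point_val (?pts v))]) (P (length (?pts v))) (G (?pts v))" for v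
    unfolding node_points_def by (rule build)
  have "runs_in (exec w prim (While 2 insert_loop ;; Move 9 3 ;;
     Arith 5 Add 5 5 ;; Arith 6 Less 9 5 ;; While 6 (node_loop build) ;; Freeze 0 10 5) (?R, M)) (?T + 3 + B)
     (\<lambda>(R, M). tree_for G N x f xs (R 0))"
  proof (rule runs_in_SeqI[OF ins])
    fix R' M'
    assume "case (R', M') of (R', M') \<Rightarrow> (\<forall>i\<in>{3,4,5,10}. R' i = ?R i) \<and> M' 0 = zero_val \<and>
       (\<forall>v\<ge>1. M' v = list_val (map point_val (rev (node_points N x f (rev xs) v))))"
    then have R': "R' 3 = Scalar (Word 1)" "R' 5 = Scalar (Word N)" "R' 10 = zero_val" and M': "M' 0 = zero_val"
        "\<And>v. 1 \<le> v \<Longrightarrow> M' v = list_val (map point_val (?pts v))"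
      using R by (auto simp: node_points_simps)
    let ?R' = "R'(9 := Scalar (Word 1), 5 := Scalar (Word (2 * N)), 6 := Scalar (Word 1))"
    have "runs_in (exec w prim (While 6 (node_loop build) ;; Freeze 0 10 5) (?R', M')) B
     (\<lambda>(R, M). tree_for G N x f xs (R 0))"
      unfolding tree_for_def B_def
      by (rule run_nodes[OF w(1) N]) (use R' M' len bld in auto)
    moreover have "(N + N) mod 2 ^ w = 2 * N" "1 < 2 * N" "(1::nat) < 2 ^ w" using N w by auto
    ultimately show "runs_in (exec w prim (Move 9 3 ;; Arith 5 Add 5 5 ;; Arith 6 Less 9 5 ;; While 6 (node_loop build) ;; Freeze 0 10 5) (R', M'))
       (?T + 3 + B - ?T) (\<lambda>(R, M). tree_for G N x f xs (R 0))"
      using w by (intro runs_in_instr) (simp add: R' del: exec.simps)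
  qed
  then have "runs_in (exec w prim (tree_com build) (R, M)) (?T + 3 + B + 2) (\<lambda>(R, M). tree_for G N x f xs (R 0))"
    unfolding tree_com_def by (intro runs_in_instr) (use x2 w in \<open>simp add: R8 R ac_simps del: exec.simps\<close>)
  then show ?thesis
    by (rule runs_in_weaken) (simp_all add: N_def B_def)
qed

text \<open>
  Since \<open>2 ^ w\<close> does not fit into a word, \<open>x\<close> is drawn below \<open>2 ^ (w - 1)\<close>, which is computed as
  \<open>(0 - 1) div 2 + 1\<close>. Then \<open>2 * x + 1\<close> is a uniformly random odd word, and wrapping does not
  affect products modulo the power of two \<open>N\<close>.
\<close>

definition prep_com :: "'o com" where
  "prep_com = Length 1 0 ;; Call 2 tag_com [0] ;; Const 3 1 ;; Const 4 2 ;; Const 5 1 ;; Arith 6 Less 5 1 ;;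
     While 6 (Arith 5 Add 5 5 ;; Arith 6 Less 5 1) ;;
     Const 7 0 ;; Arith 7 Sub 7 3 ;; Arith 7 Div 7 4 ;; Arith 7 Add 7 3"

lemma run_prep:
  fixes xs :: "('a \<times> nat) list"
  assumes w: "2 \<le> w" "4 * length xs + 4 < 2 ^ w"
  shows "runs_in (exec w prim prep_com
      (\<lambda>i. if i < length [Arr (map point_val xs)] then [Arr (map point_val xs)] ! i else zero_val, \<lambda>_. zero_val))
      (33 * real (length xs) + 20) (\<lambda>s. \<exists>L f. prepared w xs L f s)"
proof -
  define n where "n = length xs"
  have w0: "0 < w" and w1: "(2::nat) < 2 ^ w" and n: "n < 2 ^ w" "4 * n + 4 < 2 ^ w" using w by (auto simp: n_def)
  have half: "((2::nat) ^ w - 1) div 2 + 1 = 2 ^ (w - 1)" "(2::nat) ^ (w - 1) < 2 ^ w" 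
  proof -
    obtain k where k: "w = Suc k" using w(1) by (cases w) auto
    have "(2 * m - 1) div 2 + 1 = m" if "0 < m" for m :: nat using that by presburger
    from this[of "2 ^ k"] show "((2::nat) ^ w - 1) div 2 + 1 = 2 ^ (w - 1)" by (simp add: k)
  qed (use w(1) in simp)
  show ?thesis unfolding prep_com_def
  proof (intro runs_in_instr, rule runs_in_Seq_Call)
    let ?R = "(\<lambda>i. if i < length [Arr (map point_val xs)] then [Arr (map point_val xs)] ! i else zero_val)
        (1 := word w (length (elems_of (if 0 < length [Arr (map point_val xs)] then [Arr (map point_val xs)] ! 0 else zero_val))))"
    show "runs_in (run w prim tag_com (map ?R [0])) (30 * real (length xs) + 5)
       (\<lambda>v. \<exists>f. numbering xs f \<and> v = list_val (rev (map (item_val f) xs)))"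
      using run_tag[of xs w prim] w by simp
    fix v assume "\<exists>f. numbering xs f \<and> v = list_val (rev (map (item_val f) xs))"
    then obtain f where f: "numbering xs f" and v: "v = list_val (rev (map (item_val f) xs))" by blast
    define I where "I j s = (case s of (R, M) \<Rightarrow> (j = 0 \<or> 2 ^ j < 2 * n) \<and>
      R 1 = Scalar (Word n) \<and> R 2 = v \<and> R 3 = Scalar (Word 1) \<and> R 4 = Scalar (Word 2) \<and> R 5 = Scalar (Word (2 ^ j)) \<and>
      R 6 = bool_val (2 ^ j < n) \<and> R 10 = zero_val \<and> M = (\<lambda>_. zero_val))" for j and s :: "'a state"
    show "runs_in (exec w prim (Const 3 1 ;; Const 4 2 ;; Const 5 1 ;; Arith 6 Less 5 1 ;;
      While 6 (Arith 5 Add 5 5 ;; Arith 6 Less 5 1) ;;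
      Const 7 0 ;; Arith 7 Sub 7 3 ;; Arith 7 Div 7 4 ;; Arith 7 Add 7 3) (?R(2 := v), \<lambda>_. zero_val))
      (33 * real (length xs) + 20 - 1 - (30 * real (length xs) + 5) - 1) (\<lambda>s. \<exists>L f. prepared w xs L f s)"
    \<comment> \<open>The potential is linear although the number of doublings is logarithmic; this
      is harmless next to the linear cost of tagging.\<close>
    proof (intro runs_in_instr, rule runs_in_Seq_While[where I = I and g = 0 and \<phi> = "\<lambda>j. 3 * real (n - 2 ^ j) + 1"])
      fix j R M assume I: "I j (R, M)" and "R 6 \<noteq> zero_val"
      then have j: "2 ^ j < n" by (auto simp: I_def)
      have "I (Suc j) s \<and> 2 + 1 + (3 * real (n - 2 ^ Suc j) + 1) \<le> 3 * real (n - 2 ^ j) + 1" if "I (Suc j) s" for s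
      proof -
        have "(1::nat) \<le> 2 ^ j" by simp
        then have "Suc (n - 2 ^ Suc j) \<le> n - 2 ^ j" using j by (simp only: power_Suc)
        then have "real (Suc (n - 2 ^ Suc j)) \<le> real (n - 2 ^ j)" by (simp only: of_nat_le_iff)
        then show ?thesis using that by (simp del: of_nat_diff)
      qed
      moreover have "runs_in (exec w prim (Arith 5 Add 5 5 ;; Arith 6 Less 5 1) (R, M)) 2 (I (Suc j))"
      proof -
        have "(2 ^ j + 2 ^ j) mod 2 ^ w = (2 * 2 ^ j :: nat)" using j n by simp
        moreover have "(2::nat) * 2 ^ j < 2 * n" using j by simp
        ultimately show ?thesis
          using I j w0 by (intro runs_in_instr) (simp add: I_def)
      qed
      ultimately show "\<exists>T. runs_in (exec w prim (Arith 5 Add 5 5 ;; Arith 6 Less 5 1) (R, M)) T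
          (\<lambda>s'. \<exists>g'. I g' s' \<and> T + 1 + (3 * real (n - 2 ^ g') + 1) \<le> 3 * real (n - 2 ^ j) + 1)"
        by (intro exI[of _ 2], elim runs_in_weaken) blast+
    next
      fix j R M assume I: "I j (R, M)" and "R 6 = zero_val"
      then have j: "n \<le> 2 ^ j" by (auto simp: I_def split: if_splits)
      have "prepared w xs j f (R', M)" if "R' 7 = Scalar (Word (2 ^ (w - 1)))" "\<And>i. i \<noteq> 7 \<Longrightarrow> R' i = R i" for R'
        using that I f j v by (simp add: prepared_def I_def n_def rev_map)
      then have "\<exists>L f. prepared w xs L f (R', M)" if "R' 7 = Scalar (Word (2 ^ (w - 1)))" "\<And>i. i \<noteq> 7 \<Longrightarrow> R' i = R i" for R'
        using that by blast
      then show "runs_in (exec w prim (Const 7 0 ;; Arith 7 Sub 7 3 ;; Arith 7 Div 7 4 ;; Arith 7 Add 7 3) (R, M))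
         (33 * real (length xs) + 20 - 1 - (30 * real (length xs) + 5) - 1 - 1 - 1 - 1 - 1 - (3 * real (n - 2 ^ 0) + 1))
         (\<lambda>s. \<exists>L f. prepared w xs L f s)"
        using I w0 w1 n half
        by (intro runs_in_instr) (simp add: I_def n_def of_nat_diff)
    qed (use n w0 w1 in \<open>auto simp: I_def n_def\<close>)
  qed
qed

text \<open>For correctness and preprocessing time every outcome is as good as any other; the
  uniform distribution enters through \<open>nn_integral_exec_Rand\<close>.\<close>

lemma runs_in_Rand:
  assumes "word_of (R i) = m" and "0 < m" and "m < 2 ^ w"
  shows "runs_in (exec w prim (Rand r i) (R, M)) 1 (\<lambda>s. \<exists>x<m. s = (R(r := Scalar (Word x)), M))"
  using assms by (auto simp: runs_in_iff Let_def nn_integral_spmf_of_set o_def ennreal_of_nat_eq_real_of_nat divide_ennreal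
      measure_spmf.subprob_emeasure_le_1)

definition build_com :: "'o com \<Rightarrow> 'o com" where
  "build_com build = prep_com ;; Rand 8 7 ;; tree_com build"

section \<open>Reporting\<close>

text \<open>A partition of \<open>K\<close> into the output and the color sets of the pending nodes:
  this is why each color is reported exactly once without a test for duplicates.\<close>

definition agenda :: "nat \<Rightarrow> (nat \<Rightarrow> nat) \<Rightarrow> nat set \<Rightarrow> nat list \<Rightarrow> nat list \<Rightarrow> bool" where
  "agenda N leaf K st out \<longleftrightarrow> (\<forall>v\<in>set st. 1 \<le> v \<and> v < 2 * N) \<and> distinct out \<and>
     sorted_wrt (\<lambda>u v. colors_below leaf K u \<inter> colors_below leaf K v = {}) st \<and>
     (\<forall>v\<in>set st. set out \<inter> colors_below leaf K v = {}) \<and>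
     set out \<union> (\<Union>v\<in>set st. colors_below leaf K v) = K"

lemma agenda_drop:
  "agenda N leaf K (v # st) out \<Longrightarrow> colors_below leaf K v = {} \<Longrightarrow> agenda N leaf K st out"
  by (auto simp: agenda_def)

lemma agenda_report:
  "agenda N leaf K (v # st) out \<Longrightarrow> colors_below leaf K v = {c} \<Longrightarrow> agenda N leaf K st (c # out)"
  by (auto simp: agenda_def)

lemma agenda_split:
  assumes "agenda N leaf K (v # st) out" and "v < N" and "\<And>c. c \<in> K \<Longrightarrow> N \<le> leaf c"
  shows "agenda N leaf K ((2 * v + 1) # (2 * v) # st) out"
proof -
  have "colors_below leaf K v = colors_below leaf K (2 * v) \<union> colors_below leaf K (2 * v + 1)"
    using assms(2,3) by (intro colors_below_split) force
  moreover have "colors_below leaf K (2 * v) \<inter> colors_below leaf K (2 * v + 1) = {}"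
    using assms(1) by (intro colors_below_disjoint) (simp add: agenda_def)
  ultimately show ?thesis using assms(1,2) unfolding agenda_def by auto
qed

text \<open>Register 2 is the stack of pending nodes, register 3 the output; registers 4 and 6 hold
  0 and 1. \<open>Const 9 0\<close> is a no-op: the language has no skip, and the rule for
  \<open>cons_com\<close> expects a continuation.\<close>

definition report_loop :: "'o com \<Rightarrow> 'o com \<Rightarrow> 'o com" where
  "report_loop unique probe = Index 5 2 4 ;; Index 2 2 6 ;; Index 7 0 5 ;; Call 8 probe [7, 1] ;;
     If 8
       (Call 9 unique [7, 1] ;;
        If 9
          (Index 8 8 6 ;; Call 3 cons_com [8, 3] ;; Const 9 0)
          (Arith 5 Add 5 5 ;; Call 2 cons_com [5, 2] ;; Arith 5 Add 5 6 ;; Call 2 cons_com [5, 2] ;; Const 9 0))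
       (Const 9 0)"

definition report_com :: "'o com \<Rightarrow> 'o com \<Rightarrow> 'o com" where
  "report_com unique probe = Const 6 1 ;; Call 2 cons_com [6, 3] ;; While 2 (report_loop unique probe) ;;
     Call 0 to_array_com [3]"

abbreviation word_list_val :: "nat list \<Rightarrow> 'a val" where
  "word_list_val ns \<equiv> list_val (map (\<lambda>a. Scalar (Word a)) ns)"

text \<open>The set \<open>Kv\<close> abstracts from tree and agenda, so a single visit is executed
  symbolically in isolation; the disjuncts in the premise about \<open>Q\<close> are its three
  outcomes.\<close>

lemma run_report_loop:
  fixes ds :: "'a val list" and y :: "'a val"
  assumes w: "2 \<le> w" "2 * N < 2 ^ w" and ds: "length ds = 2 * N" and v: "1 \<le> v" "v < 2 * N"
    and probe: "runs_in (run w prim probe [ds ! v, y]) T0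
       (\<lambda>e. if Kv = {} then e = zero_val else \<exists>a. \<exists>c\<in>Kv. e = Arr [a, Scalar (Word c)])"
    and unique: "runs_in (run w prim unique [ds ! v, y]) T1 (\<lambda>u. u = bool_val (card Kv = 1))"
    and leaf: "card Kv \<le> 1 \<or> v < N" and fin: "finite Kv"
    and R: "R 0 = Arr ds" "R (Suc 0) = y" "R 2 = word_list_val (v # st)" "R 3 = word_list_val out"
      "R 4 = zero_val" "R 6 = Scalar (Word 1)"
    and Q: "\<And>R' st' out'. R' 0 = R 0 \<Longrightarrow> R' (Suc 0) = R (Suc 0) \<Longrightarrow> R' 4 = R 4 \<Longrightarrow> R' 6 = R 6 \<Longrightarrow>
      R' 2 = word_list_val st' \<Longrightarrow> R' 3 = word_list_val out' \<Longrightarrow>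
      Kv = {} \<and> st' = st \<and> out' = out \<or> (\<exists>c. Kv = {c} \<and> st' = st \<and> out' = c # out) \<or>
      2 \<le> card Kv \<and> v < N \<and> st' = (2 * v + 1) # (2 * v) # st \<and> out' = out \<Longrightarrow> Q (R', M)"
  shows "runs_in (exec w prim (report_loop unique probe) (R, M)) (T0 + T1 + 28) Q"
proof -
  have w0: "0 < w" using w by simp
  have T: "0 \<le> T0" "0 \<le> T1" using probe unique by (auto simp: runs_in_iff)
  let ?R = "R(5 := Scalar (Word v), 2 := word_list_val st, 7 := ds ! v)"
  have "runs_in (exec w prim (Call 8 probe [7, 1] ;;
     If 8
       (Call 9 unique [7, 1] ;;
        If 9
          (Index 8 8 6 ;; Call 3 cons_com [8, 3] ;; Const 9 0)
          (Arith 5 Add 5 5 ;; Call 2 cons_com [5, 2] ;; Arith 5 Add 5 6 ;; Call 2 cons_com [5, 2] ;; Const 9 0))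
       (Const 9 0)) (?R, M)) (T0 + T1 + 25) Q"
  proof (rule runs_in_Seq_Call)
    show "runs_in (run w prim probe (map ?R [7, 1])) T0
       (\<lambda>e. if Kv = {} then e = zero_val else \<exists>a. \<exists>c\<in>Kv. e = Arr [a, Scalar (Word c)])"
      using probe by (simp add: R)
    fix e :: "'a val" assume e: "if Kv = {} then e = zero_val else \<exists>a. \<exists>c\<in>Kv. e = Arr [a, Scalar (Word c)]"
    show "runs_in (exec w prim (If 8
       (Call 9 unique [7, 1] ;;
        If 9
          (Index 8 8 6 ;; Call 3 cons_com [8, 3] ;; Const 9 0)
          (Arith 5 Add 5 5 ;; Call 2 cons_com [5, 2] ;; Arith 5 Add 5 6 ;; Call 2 cons_com [5, 2] ;; Const 9 0))
       (Const 9 0)) (?R(8 := e), M)) (T0 + T1 + 25 - T0 - 1) Q"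
    proof (rule runs_in_IfI)
      assume "(?R(8 := e)) 8 = zero_val"
      then have "Kv = {}" using e by (auto split: if_splits)
      then show "runs_in (exec w prim (Const 9 0) (?R(8 := e), M)) (T0 + T1 + 25 - T0 - 1 - 1) Q"
        using T by (auto intro!: Q[of _ st out] simp: R)
    next
      assume "(?R(8 := e)) 8 \<noteq> zero_val"
      then obtain a c where c: "c \<in> Kv" "e = Arr [a, Scalar (Word c)]" using e by (auto split: if_splits)
      show "runs_in (exec w prim (Call 9 unique [7, 1] ;;
        If 9
          (Index 8 8 6 ;; Call 3 cons_com [8, 3] ;; Const 9 0)
          (Arith 5 Add 5 5 ;; Call 2 cons_com [5, 2] ;; Arith 5 Add 5 6 ;; Call 2 cons_com [5, 2] ;; Const 9 0)) (?R(8 := e), M))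
          (T0 + T1 + 25 - T0 - 1 - 1) Q"
      proof (rule runs_in_Seq_Call)
        show "runs_in (run w prim unique (map (?R(8 := e)) [7, 1])) T1 (\<lambda>u. u = bool_val (card Kv = 1))"
          using unique by (simp add: R)
        fix u :: "'a val" assume u: "u = bool_val (card Kv = 1)"
        show "runs_in (exec w prim (If 9
          (Index 8 8 6 ;; Call 3 cons_com [8, 3] ;; Const 9 0)
          (Arith 5 Add 5 5 ;; Call 2 cons_com [5, 2] ;; Arith 5 Add 5 6 ;; Call 2 cons_com [5, 2] ;; Const 9 0))
          (?R(8 := e, 9 := u), M)) (T0 + T1 + 25 - T0 - 1 - 1 - T1 - 1) Q"
        proof (rule runs_in_IfI)
          assume "(?R(8 := e, 9 := u)) 9 \<noteq> zero_val"
          then have "card Kv = 1" using u by auto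
          then have "Kv = {c}" using c by (metis card_1_singletonE singletonD)
          then show "runs_in (exec w prim (Index 8 8 6 ;; Call 3 cons_com [8, 3] ;; Const 9 0)
             (?R(8 := e, 9 := u), M)) (T0 + T1 + 25 - T0 - 1 - 1 - T1 - 1 - 1) Q"
            by (intro runs_in_instr runs_in_cons w) (auto intro!: Q[of _ st "c # out"] simp: R c)
        next
          assume "(?R(8 := e, 9 := u)) 9 = zero_val"
          moreover have "card Kv \<noteq> 0" using fin c by auto
          \<comment> \<open>The range is nonempty without having exactly one color, hence it has at
            least two; by \<open>leaf\<close> the node \<open>v\<close> is then internal and its
            children exist.\<close>
          ultimately have "2 \<le> card Kv" "v < N" using u leaf by (auto split: if_splits)
          moreover have "(v + v) mod 2 ^ w = 2 * v" "(2 * v + 1) mod 2 ^ w = 2 * v + 1"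
            using \<open>v < N\<close> w by auto
          ultimately show "runs_in (exec w prim (Arith 5 Add 5 5 ;; Call 2 cons_com [5, 2] ;; Arith 5 Add 5 6 ;;
             Call 2 cons_com [5, 2] ;; Const 9 0)
             (?R(8 := e, 9 := u), M)) (T0 + T1 + 25 - T0 - 1 - 1 - T1 - 1 - 1) Q"
            by (intro runs_in_instr runs_in_cons w)
              (auto intro!: Q[of _ "(2 * v + 1) # (2 * v) # st" out] simp: R)
        qed
      qed
    qed
  qed
  then show ?thesis
    unfolding report_loop_def
    by (intro runs_in_instr) (use w v ds in \<open>simp add: R ac_simps del: exec.simps\<close>)
qed

lemma run_report:
  fixes ds :: "'a val list" and y :: "'a val"
  assumes w: "2 \<le> w" "2 * N < 2 ^ w" and N: "1 \<le> N" and ds: "length ds = 2 * N"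
    and K: "finite K" "card K < 2 ^ w" and leaf: "inj_on leaf K" "\<And>c. c \<in> K \<Longrightarrow> N \<le> leaf c \<and> leaf c < 2 * N"
    and probe: "\<And>v. 1 \<le> v \<Longrightarrow> v < 2 * N \<Longrightarrow> runs_in (run w prim probe [ds ! v, y]) T0
       (\<lambda>e. if colors_below leaf K v = {} then e = zero_val
          else \<exists>a. \<exists>c\<in>colors_below leaf K v. e = Arr [a, Scalar (Word c)])"
    and unique: "\<And>v. 1 \<le> v \<Longrightarrow> v < 2 * N \<Longrightarrow> runs_in (run w prim unique [ds ! v, y]) T1
       (\<lambda>u. u = bool_val (card (colors_below leaf K v) = 1))"
  shows "runs_in (run w prim (report_com unique probe) [Arr ds, y])
     ((T0 + T1 + 29) * (1 + 2 * real (card (branching N leaf K 1))) + 6 * real (card K) + 15)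
     (\<lambda>z. \<exists>cs. z = Arr (map (\<lambda>a. Scalar (Word a)) cs) \<and> distinct cs \<and> set cs = K)"
proof -
  have w0: "0 < w" using w by simp
  have T: "0 \<le> T0" "0 \<le> T1" using probe[of 1] unique[of 1] N by (auto simp: runs_in_iff)
  define I where "I g s = (case g of (st, out) \<Rightarrow> case s of (R, M) \<Rightarrow> agenda N leaf K st out \<and>
     R 0 = Arr ds \<and> R (Suc 0) = y \<and> R 2 = word_list_val st \<and> R 3 = word_list_val out \<and> R 4 = zero_val \<and>
     R 6 = Scalar (Word 1))" for g and s :: "'a state"
  \<comment> \<open>A binary recursion tree with \<open>b\<close> branching nodes has
    \<open>1 + 2 * b\<close> visited nodes. The 29 is the 28 of the loop body plus 1 for the loop
    test.\<close>
  define pot where "pot v = (T0 + T1 + 29) * (1 + 2 * real (card (branching N leaf K v)))" for v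
  have pot: "0 \<le> pot v" "T0 + T1 + 29 \<le> pot v" for v
    using T by (auto simp: pot_def algebra_simps)
  define \<phi> where "\<phi> g = sum_list (map pot (fst g)) + 1" for g :: "nat list \<times> nat list"
  have one: "card (colors_below leaf K v) \<le> 1 \<or> v < N" for v
  proof (cases "v < N")
    case False
    have "leaf c = v" if "c \<in> colors_below leaf K v" for c
      using that leaf(2)[of c] anc_leaf[of N v "leaf c"] False by (auto simp: colors_below_def)
    then have "c = d" if "c \<in> colors_below leaf K v" "d \<in> colors_below leaf K v" for c d
      using that leaf(1) by (auto simp: colors_below_def inj_on_def)
    moreover have "finite (colors_below leaf K v)" using K by (simp add: colors_below_def)
    ultimately have "card (colors_below leaf K v) \<le> Suc 0" by (subst card_le_Suc0_iff_eq) auto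
    then show ?thesis by simp
  qed simp
  have init: "agenda N leaf K [1] []"
    using N leaf(2) anc_root by (fastforce simp: agenda_def colors_below_def)
  show ?thesis unfolding report_com_def
  proof (intro runs_in_run runs_in_instr runs_in_cons w(1), rule runs_in_Seq_While[where I = I and g = "([1], [])" and \<phi> = \<phi>])
    fix g R M assume I: "I g (R, M)" and "R 2 \<noteq> zero_val"
    then obtain v st out where g: "g = (v # st, out)"
      by (cases g; cases "fst g") (auto simp: I_def)
    have ag: "agenda N leaf K (v # st) out" and R: "R 0 = Arr ds" "R (Suc 0) = y" "R 2 = word_list_val (v # st)"
      "R 3 = word_list_val out" "R 4 = zero_val" "R 6 = Scalar (Word 1)"
      using I by (auto simp: I_def g)
    then have v: "1 \<le> v" "v < 2 * N" by (auto simp: agenda_def)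
    have fin: "finite (colors_below leaf K v)" using K by (simp add: colors_below_def)
    have "runs_in (exec w prim (report_loop unique probe) (R, M)) (T0 + T1 + 28)
       (\<lambda>s'. \<exists>g'. I g' s' \<and> T0 + T1 + 28 + 1 + \<phi> g' \<le> \<phi> g)"
    proof (rule run_report_loop[OF w ds v probe[OF v] unique[OF v] one fin R])
      fix R' st' out' assume R': "R' 0 = R 0" "R' (Suc 0) = R (Suc 0)" "R' 4 = R 4" "R' 6 = R 6"
        "R' 2 = word_list_val st'" "R' 3 = word_list_val out'"
        and "colors_below leaf K v = {} \<and> st' = st \<and> out' = out \<or>
          (\<exists>c. colors_below leaf K v = {c} \<and> st' = st \<and> out' = c # out) \<or>
          2 \<le> card (colors_below leaf K v) \<and> v < N \<and> st' = (2 * v + 1) # (2 * v) # st \<and> out' = out"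
      then consider "colors_below leaf K v = {}" "st' = st" "out' = out"
        | c where "colors_below leaf K v = {c}" "st' = st" "out' = c # out"
        | "2 \<le> card (colors_below leaf K v)" "v < N" "st' = (2 * v + 1) # (2 * v) # st" "out' = out"
        by blast
      then have "agenda N leaf K st' out' \<and> T0 + T1 + 28 + 1 + \<phi> (st', out') \<le> \<phi> g"
      proof cases
        case 1
        then show ?thesis using agenda_drop[OF ag] pot[of v] by (auto simp: \<phi>_def g)
      next
        case 2
        then show ?thesis using agenda_report[OF ag] pot[of v] by (auto simp: \<phi>_def g)
      next
        case 3
        have "pot v = T0 + T1 + 29 + pot (2 * v) + pot (2 * v + 1)"
          unfolding pot_def card_branching[OF v 3(1)] by (simp add: algebra_simps)
        then show ?thesis using 3 agenda_split[OF ag] leaf(2) by (simp add: \<phi>_def g)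
      qed
      then show "\<exists>g'. I g' (R', M) \<and> T0 + T1 + 28 + 1 + \<phi> g' \<le> \<phi> g"
        using R R' by (intro exI[of _ "(st', out')"]) (simp add: I_def)
    qed
    then show "\<exists>T. runs_in (exec w prim (report_loop unique probe) (R, M)) T
       (\<lambda>s'. \<exists>g'. I g' s' \<and> T + 1 + \<phi> g' \<le> \<phi> g)" by blast
  next
    fix g R M assume I: "I g (R, M)" and R2: "R 2 = zero_val"
    obtain st out where "g = (st, out)" by (cases g)
    moreover from this have "word_list_val st = (zero_val :: 'a val)" using I R2 by (simp add: I_def)
    ultimately have g: "g = ([], out)" by simp
    have out: "distinct out" "set out = K" and R3: "R 3 = word_list_val out"
      using I by (auto simp: I_def g agenda_def)
    have "length out = card K" using out distinct_card by fastforce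
    then have "runs_in (run w prim to_array_com (map R [3])) (6 * real (card K) + 3)
       (\<lambda>z. z = Arr (map (\<lambda>a. Scalar (Word a)) out))"
      using run_to_array[of "map (\<lambda>a. Scalar (Word a)) out" w prim] K w by (simp add: R3)
    \<comment> \<open>The 15 splits into 1 + 9 for the initial stack, 1 for the final loop test, and
      1 + 3 for calling the conversion to an array.\<close>
    then show "runs_in (exec w prim (Call 0 to_array_com [3]) (R, M))
       ((T0 + T1 + 29) * (1 + 2 * real (card (branching N leaf K 1))) + 6 * real (card K) + 15 - 1 - 9 - \<phi> ([1], []))
       (\<lambda>(R, M). \<exists>cs. R 0 = Arr (map (\<lambda>a. Scalar (Word a)) cs) \<and> distinct cs \<and> set cs = K)"
      by (rule runs_in_CallI) (use out in \<open>auto simp: \<phi>_def pot_def\<close>)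
  qed (use w0 init pot in \<open>auto simp: I_def \<phi>_def intro!: sum_list_nonneg\<close>)
qed

section \<open>Bounds for time and space\<close>

lemma exec_time_pos: "(s', t) \<in> set_spmf (exec w prim c s) \<Longrightarrow> 1 \<le> t"
proof (induction c arbitrary: s s' t)
  case (Call r c js)
  then show ?case by (cases s) auto
next
  case (Seq c1 c2)
  from Seq.prems obtain s1 t1 t2 where "(s1, t1) \<in> set_spmf (exec w prim c1 s)" "t = t1 + t2"
    by (auto simp: set_bind_spmf)
  with Seq.IH(1) show ?case by fastforce
next
  case (If i c1 c2)
  then show ?case by (cases "fst s i = zero_val") auto
next
  case (While i c)
  then show ?case
    by (subst (asm) exec.simps, subst (asm) while_loop.simps) (auto simp: set_bind_spmf split: if_splits)
next
  case (Rand r i)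
  then show ?case by (cases s) (auto simp: Let_def)
qed (simp_all add: Let_def case_prod_unfold)

lemma run_time_pos: "(v, t) \<in> set_spmf (run w prim c args) \<Longrightarrow> 1 \<le> t"
  by (auto simp: run_def dest: exec_time_pos)

lemma runs_in_nonempty:
  assumes "runs_in p T Q" shows "\<exists>v t. (v, t) \<in> set_spmf p \<and> Q v"
  using set_spmf_nonempty[OF runs_in_lossless[OF assms]] assms by (fastforce simp: runs_in_iff)

text \<open>Every program spends at least one step, so any valid time bound is at least 1. This is
  the source of the lower bounds on the otherwise arbitrary \<open>P\<close>, \<open>Q0\<close> and
  \<open>Q1\<close>.\<close>

lemma runs_in_run_ge_1:
  assumes "runs_in (run w prim c args) T Q" shows "1 \<le> T"
proof -
  let ?p = "run w prim c args"
  have "ennreal 1 = (\<integral>\<^sup>+ x. 1 \<partial>measure_spmf ?p)"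
    using runs_in_lossless[OF assms]
    by (simp add: lossless_spmf_def weight_spmf_def measure_spmf.emeasure_eq_measure space_measure_spmf)
  also have "\<dots> \<le> (\<integral>\<^sup>+ x. of_nat (snd x) \<partial>measure_spmf ?p)"
    using run_time_pos[of _ _ w prim c args]
    by (intro nn_integral_mono_AE) (force simp: AE_measure_spmf_iff)
  also have "\<dots> \<le> ennreal T" using assms by (simp add: runs_in_iff)
  finally show ?thesis using assms by (simp add: runs_in_iff ennreal_le_iff del: ennreal_1)
qed

text \<open>A negative \<open>T\<close> would be clipped to 0 by \<open>ennreal\<close>, but no run
  has expected time 0.\<close>

lemma runs_in_expected_time:
  assumes "expected_time (run w prim c args) \<le> ennreal T" and "returns (run w prim c args) Q"
  shows "runs_in (run w prim c args) T Q"
proof (cases "0 \<le> T")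
  case False
  then have "expected_time (run w prim c args) \<le> ennreal 0" using assms(1) by (simp add: ennreal_neg)
  then have "runs_in (run w prim c args) 0 Q" using assms(2) by (simp add: runs_in_def)
  from runs_in_run_ge_1[OF this] show ?thesis by simp
qed (use assms in \<open>simp add: runs_in_def\<close>)

lemma runs_in_terminates_within:
  assumes "terminates_within p T" and "returns p Q"
  shows "runs_in p T Q"
proof -
  obtain v t where "(v, t) \<in> set_spmf p"
    using assms(1) set_spmf_nonempty by (fastforce simp: terminates_within_def)
  then have "0 \<le> T" using assms(1) by (force simp: terminates_within_def)
  moreover have "(\<integral>\<^sup>+ x. of_nat (snd x) \<partial>measure_spmf p) \<le> ennreal T"
    using assms(1) by (intro nn_integral_spmf_le)
      (fastforce simp: terminates_within_def ennreal_of_nat_eq_real_of_nat intro: ennreal_leI)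
  ultimately show ?thesis using assms by (auto simp: runs_in_iff terminates_within_def returns_def)
qed

text \<open>The given contract recast in terms of \<open>runs_in\<close>, with the witness point
  described through its color, which is what the report reads from it.\<close>

definition node_ok ::
  "(nat \<Rightarrow> 'a set) \<Rightarrow> ('a \<Rightarrow> 'a set) \<Rightarrow> (nat \<Rightarrow> 'o \<Rightarrow> 'a scalar list \<Rightarrow> 'a scalar) \<Rightarrow> 'o com \<Rightarrow> 'o com \<Rightarrow>
   (nat \<Rightarrow> real) \<Rightarrow> (nat \<Rightarrow> real) \<Rightarrow> (nat \<Rightarrow> real) \<Rightarrow> nat \<Rightarrow> ('a \<times> nat) list \<Rightarrow> 'a val \<Rightarrow> bool"
where
  "node_ok V rng prim unique probe S Q0 Q1 w ys d \<longleftrightarrow> real (vsize d) \<le> S (length ys) \<and>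
     (\<forall>q\<in>V w.
        runs_in (run w prim unique [d, Scalar (Atom q)]) (Q1 (length ys))
          (\<lambda>v. v = bool_val (card (colors_in (set ys) (rng q)) = 1)) \<and>
        runs_in (run w prim probe [d, Scalar (Atom q)]) (Q0 (length ys))
          (\<lambda>v. if colors_in (set ys) (rng q) = {} then v = zero_val
             else \<exists>a. \<exists>c\<in>colors_in (set ys) (rng q). v = Arr [a, Scalar (Word c)]))"

lemma node_okI:
  assumes "real (vsize d) \<le> S (length ys)"
    and "\<And>q. q \<in> V w \<Longrightarrow>
      terminates_within (run w prim unique [d, Scalar (Atom q)]) (Q1 (length ys)) \<and>
      returns (run w prim unique [d, Scalar (Atom q)])
        (\<lambda>v. v = bool_val (card (colors_in (set ys) (rng q)) = 1)) \<and>
      terminates_within (run w prim probe [d, Scalar (Atom q)]) (Q0 (length ys)) \<and>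
      returns (run w prim probe [d, Scalar (Atom q)])
        (\<lambda>v. if points_in (set ys) (rng q) = {} then v = zero_val
             else v \<in> point_val ` points_in (set ys) (rng q))"
  shows "node_ok V rng prim unique probe S Q0 Q1 w ys d"
  unfolding node_ok_def
proof (intro conjI ballI)
  fix q assume q: "q \<in> V w"
  show "runs_in (run w prim unique [d, Scalar (Atom q)]) (Q1 (length ys))
     (\<lambda>v. v = bool_val (card (colors_in (set ys) (rng q)) = 1))"
    using assms(2)[OF q] by (intro runs_in_terminates_within) auto
  have "runs_in (run w prim probe [d, Scalar (Atom q)]) (Q0 (length ys))
     (\<lambda>v. if points_in (set ys) (rng q) = {} then v = zero_val
          else v \<in> point_val ` points_in (set ys) (rng q))"
    using assms(2)[OF q] by (intro runs_in_terminates_within) auto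
  then show "runs_in (run w prim probe [d, Scalar (Atom q)]) (Q0 (length ys))
     (\<lambda>v. if colors_in (set ys) (rng q) = {} then v = zero_val
       else \<exists>a. \<exists>c\<in>colors_in (set ys) (rng q). v = Arr [a, Scalar (Word c)])"
    by (rule runs_in_weaken) (auto simp: colors_in_def point_val_def split: if_splits)
qed (rule assms(1))

lemma uniqueness_structureE:
  assumes "uniqueness_structure U V rng prim P S Q0 Q1"
  obtains c build unique probe where
    "\<And>w xs. admissible U c w xs \<Longrightarrow> runs_in (run w prim build [Arr (map point_val xs)]) (P (length xs))
       (node_ok V rng prim unique probe S Q0 Q1 w xs)"
proof -
  from assms[unfolded uniqueness_structure_def] obtain c build unique probe where *:
    "\<forall>w xs. admissible U c w xs \<longrightarrow>
      (let n = length xs; X = set xs; D = run w prim build [Arr (map point_val xs)] in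
         expected_time D \<le> ennreal (P n) \<and>
         returns D (\<lambda>d. real (vsize d) \<le> S n \<and>
           (\<forall>q \<in> V w.
              let A1 = run w prim unique [d, Scalar (Atom q)];
                  A0 = run w prim probe [d, Scalar (Atom q)]
              in terminates_within A1 (Q1 n) \<and>
                 returns A1 (\<lambda>v. v = bool_val (card (colors_in X (rng q)) = 1)) \<and>
                 terminates_within A0 (Q0 n) \<and>
                 returns A0 (\<lambda>v. if points_in X (rng q) = {} then v = zero_val
                   else v \<in> point_val ` points_in X (rng q)))))"
    by blast
  show ?thesis
  proof (rule that)
    fix w xs assume "admissible U c w xs"
    note D = *[rule_format, OF this, unfolded Let_def]
    show "runs_in (run w prim build [Arr (map point_val xs)]) (P (length xs))
       (node_ok V rng prim unique probe S Q0 Q1 w xs)"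
      by (rule runs_in_weaken[OF runs_in_expected_time[OF D[THEN conjunct1] D[THEN conjunct2]] order_refl])
         (rule node_okI; simp)
  qed
qed

section \<open>Summing costs over the tree\<close>

lemma sum_length_node_points:
  "(\<Sum>v=1..<2 * 2 ^ L. length (node_points (2 ^ L) x f xs v)) \<le> (L + 1) * length xs"
proof (induction xs)
  case Nil
  then show ?case by (simp add: node_points_simps)
next
  case (Cons p xs)
  let ?u = "2 ^ L + hash (2 ^ L) x (f (snd p))"
  have eq: "length (node_points (2 ^ L) x f (p # xs) v) = of_bool (anc v ?u) + length (node_points (2 ^ L) x f xs v)" for v
    by (simp add: node_points_simps)
  have "(\<Sum>v=1..<2 * 2 ^ L. of_bool (anc v ?u)) = card ({1..<2 * 2 ^ L} \<inter> {v. anc v ?u})"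
    by simp
  also have "\<dots> \<le> card {v. 1 \<le> v \<and> anc v ?u}"
    by (rule card_mono) (auto intro: finite_subset[of _ "{..?u}"] dest: anc_le)
  also have "\<dots> \<le> Suc L"
    using hash_less[of "2 ^ L" x] by (intro card_anc_le) simp
  finally have "(\<Sum>v=1..<2 * 2 ^ L. of_bool (anc v ?u)) \<le> Suc L" .
  then show ?case using Cons by (simp add: eq sum.distrib)
qed

text \<open>For sizes \<open>m\<close> from 1 to \<open>n\<close>, monotonicity gives
  \<open>F m \<le> m * (F n / n)\<close>, and the sizes add up to at most
  \<open>(L + 1) * n\<close>. Empty nodes fall outside the monotone range; the first summand grants
  \<open>F 0\<close> to each of the fewer than \<open>2 * 2 ^ L\<close> nodes.\<close>

lemma sum_node_bound:
  fixes F :: "nat \<Rightarrow> real"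
  assumes mono: "mono_on {1..} (\<lambda>n. F n / real n)" and F: "0 \<le> F 0" "0 \<le> F (length xs)"
  shows "(\<Sum>v=1..<2 * 2 ^ L. F (length (node_points (2 ^ L) x f xs v))) \<le> 2 * 2 ^ L * F 0 + (real L + 1) * F (length xs)"
proof -
  define n where "n = length xs"
  define pts where "pts = node_points (2 ^ L) x f xs"
  have le: "length (pts v) \<le> n" for v by (simp add: pts_def node_points_def n_def)
  have F_le: "F m \<le> F 0 + real m * (F n / real n)" if "m \<le> n" for m
  proof (cases "m = 0")
    case False
    then have "F m / real m \<le> F n / real n" using that mono by (intro mono_onD[OF mono]) auto
    then have "F m \<le> real m * (F n / real n)" using False by (simp add: divide_le_eq mult.commute)
    then show ?thesis using F by simp
  qed simp
  have "(\<Sum>v=1..<2 * 2 ^ L. F (length (pts v))) \<le> (\<Sum>v=1..<2 * 2 ^ L. F 0 + real (length (pts v)) * (F n / real n))"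
    using F_le le by (intro sum_mono) auto
  also have "\<dots> = real (2 * 2 ^ L - 1) * F 0 + real (\<Sum>v=1..<2 * 2 ^ L. length (pts v)) * (F n / real n)"
    by (simp add: sum.distrib sum_distrib_right sum_divide_distrib)
  also have "\<dots> \<le> 2 * 2 ^ L * F 0 + real ((L + 1) * n) * (F n / real n)"
  proof (intro add_mono mult_right_mono)
    have "real (2 * 2 ^ L - 1) \<le> real (2 * 2 ^ L)" by (simp only: of_nat_le_iff)
    then show "real (2 * 2 ^ L - 1) \<le> 2 * 2 ^ L" by simp
    show "real (\<Sum>v=1..<2 * 2 ^ L. length (pts v)) \<le> real ((L + 1) * n)"
      unfolding of_nat_le_iff pts_def n_def by (rule sum_length_node_points)
  qed (use F in \<open>auto simp: n_def\<close>)
  also have "\<dots> \<le> 2 * 2 ^ L * F 0 + (real L + 1) * F n"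
  proof (cases "n = 0")
    case False
    then have "real ((L + 1) * n) * (F n / real n) = (real L + 1) * F n" by (simp add: field_simps)
    then show ?thesis by simp
  qed (use F in \<open>simp add: n_def\<close>)
  finally show ?thesis by (simp add: pts_def n_def)
qed

text \<open>The logarithm vanishes at 1, so inputs below 2 get a value of their own, which does not
  affect the growth rate. The constant \<open>F 0\<close> appears as a factor to absorb the cost of
  empty nodes.\<close>

definition cost_bound :: "(nat \<Rightarrow> real) \<Rightarrow> nat \<Rightarrow> real" where
  "cost_bound F n = (if n < 2 then 200 * (1 + \<bar>F 0\<bar> + \<bar>F n\<bar>) else 200 * \<bar>F 0\<bar> * (F n * log 2 (real n)))"

lemma cost_bound_bigo: "cost_bound F \<in> O(\<lambda>n. F n * log 2 (real n))"
  by (rule bigoI[of _ "200 * \<bar>F 0\<bar>"])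
    (auto simp: cost_bound_def abs_mult eventually_at_top_linorder intro!: exI[of _ 2])

lemma cost_bound_ge:
  assumes F: "1 \<le> F 0" "1 \<le> F n" "real n \<le> F n" and L: "L = 0 \<or> 2 ^ L < 2 * n"
  shows "57 * real n + 29 + 13 * real L * real n + 22 * 2 ^ L + 2 * 2 ^ L * F 0 + (real L + 1) * F n + 6 * (real L + 1) * real n
     \<le> cost_bound F n"
proof (cases "n < 2")
  case True
  have "L = 0"
  proof (rule ccontr)
    assume "L \<noteq> 0"
    then have "(2::nat) ^ 1 \<le> 2 ^ L" by (intro power_increasing) auto
    then show False using L True \<open>L \<noteq> 0\<close> by auto
  qed
  then show ?thesis using True F by (simp add: cost_bound_def)
next
  case False
  define l where "l = log 2 (real n)"
  have l: "1 \<le> l" using False by (simp add: l_def le_log_iff)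
  have N: "(2::real) ^ L \<le> 2 * n" and Ll: "real L \<le> 2 * l"
  proof -
    have "(2::nat) ^ L \<le> 2 * n" using L False by auto
    then have "real (2 ^ L) \<le> real (2 * n)" by (simp only: of_nat_le_iff)
    then show N: "(2::real) ^ L \<le> 2 * n" by simp
    have "log 2 (2 ^ L) \<le> log 2 (2 * real n)" using N False by (subst log_le_cancel_iff) auto
    also have "\<dots> = 1 + l" using False by (simp add: l_def log_mult)
    finally show "real L \<le> 2 * l" using l by simp
  qed
  let ?B = "F 0 * (F n * l)"
  have Fl: "F n \<le> F n * l" using F l by (simp add: mult_le_cancel_left1)
  have B0: "F n * l \<le> ?B" using F l mult_right_mono[of 1 "F 0" "F n * l"] by simp
  have n: "real n \<le> ?B" using F Fl B0 by linarith
  have one: "1 \<le> ?B" using F Fl B0 by linarith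
  have Ln: "real L * real n \<le> 2 * ?B"
  proof -
    have "real L * real n \<le> (2 * l) * F n" using Ll F l by (intro mult_mono) auto
    also have "\<dots> \<le> 2 * ?B" using B0 by (simp add: mult.commute[of l])
    finally show ?thesis .
  qed
  have LF: "real L * F n \<le> 2 * ?B"
  proof -
    have "real L * F n \<le> (2 * l) * F n" using Ll F by (intro mult_right_mono) auto
    also have "\<dots> \<le> 2 * ?B" using B0 by (simp add: mult.commute[of l])
    finally show ?thesis .
  qed
  have NF: "2 ^ L * F 0 \<le> 2 * ?B"
  proof -
    have "2 ^ L \<le> 2 * (F n * l)" using N F Fl by linarith
    then have "2 ^ L * F 0 \<le> (2 * (F n * l)) * F 0" using F by (intro mult_right_mono) auto
    then show ?thesis by (simp add: mult_ac)
  qed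
  have FB: "F n \<le> ?B" using Fl B0 by linarith
  have "57 * real n + 29 + 13 * (real L * real n) + 22 * 2 ^ L + 2 * (2 ^ L * F 0) + (real L * F n + F n) + 6 * (real L * real n + real n)
     \<le> 200 * ?B"
  proof -
    \<comment> \<open>With \<open>c \<le> 2 * a\<close>, the coefficients add up to 57 + 29 + 26 +
      44 + 4 + 3 + 18 = 181, which 200 covers.\<close>
    have "57 * a + 29 + 13 * b + 22 * c + 2 * d + (e + g) + 6 * (b + a) \<le> 200 * B"
      if "a \<le> B" "1 \<le> B" "b \<le> 2 * B" "e \<le> 2 * B" "d \<le> 2 * B" "c \<le> 2 * a" "g \<le> B" for a b c d e g B :: real
      using that by argo
    from this[OF n one Ln LF NF _ FB] N show ?thesis by simp
  qed
  then show ?thesis using False F by (simp add: cost_bound_def l_def algebra_simps)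
qed

section \<open>Averaging over the random multiplier\<close>

lemma nn_integral_exec_Seq:
  "(\<integral>\<^sup>+ y. h (fst y) \<partial>measure_spmf (exec w prim (c1 ;; c2) s)) =
   (\<integral>\<^sup>+ z. (\<integral>\<^sup>+ y. h (fst y) \<partial>measure_spmf (exec w prim c2 (fst z))) \<partial>measure_spmf (exec w prim c1 s))"
  by (simp add: nn_integral_bind_spmf case_prod_unfold measure_spmf_return_spmf nn_integral_return)

lemma nn_integral_exec_Rand:
  assumes "word_of (R i) = m" and "0 < m" and "m < 2 ^ w"
  shows "(\<integral>\<^sup>+ y. h (fst y) \<partial>measure_spmf (exec w prim (Rand r i) (R, M))) =
    (\<Sum>x<m. h (R(r := Scalar (Word x)), M)) / of_nat m"
proof -
  have "(\<integral>\<^sup>+ y. h (fst y) \<partial>measure_spmf (exec w prim (Rand r i) (R, M))) =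
     (\<Sum>x\<in>{0..<m}. h (R(r := word w x), M)) / of_nat m"
    using assms by (simp add: Let_def nn_integral_spmf_of_set o_def)
  also have "(\<Sum>x\<in>{0..<m}. h (R(r := word w x), M)) = (\<Sum>x<m. h (R(r := Scalar (Word x)), M))"
    using assms by (intro sum.cong) auto
  finally show ?thesis .
qed

lemma expected_time_bind:
  assumes "lossless_spmf D" and "\<And>d t. (d, t) \<in> set_spmf D \<Longrightarrow> lossless_spmf (k d)"
  shows "expected_time (bind_spmf D (\<lambda>(d, t). k d)) = (\<integral>\<^sup>+ x. expected_time (k (fst x)) \<partial>measure_spmf D)"
proof -
  have "lossless_spmf (bind_spmf D (\<lambda>(d, t). k d))" using assms by auto
  then have "expected_time (bind_spmf D (\<lambda>(d, t). k d)) =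
     (\<integral>\<^sup>+ x. (\<integral>\<^sup>+ y. of_nat (snd y) \<partial>measure_spmf (k (fst x))) \<partial>measure_spmf D)"
    by (simp add: expected_time_def nn_integral_bind_spmf case_prod_unfold)
  also have "\<dots> = (\<integral>\<^sup>+ x. expected_time (k (fst x)) \<partial>measure_spmf D)"
    using assms(2) by (intro nn_integral_cong_AE) (auto simp: AE_measure_spmf_iff expected_time_def)
  finally show ?thesis .
qed

lemma run_build:
  fixes xs :: "('a \<times> nat) list"
  assumes w: "2 \<le> w" "4 * length xs + 4 < 2 ^ w"
    and build: "\<And>Q. runs_in (run w prim build [Arr (map point_val (filter Q xs))])
      (P (length (filter Q xs))) (G (filter Q xs))"
    and P: "mono_on {1..} (\<lambda>n. P n / real n)" "1 \<le> P 0" "1 \<le> P (length xs)" "real (length xs) \<le> P (length xs)"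
  shows "runs_in (run w prim (build_com build) [Arr (map point_val xs)]) (cost_bound P (length xs))
     (\<lambda>d. \<exists>L f x. numbering xs f \<and> length xs \<le> 2 ^ L \<and> (L = 0 \<or> 2 ^ L < 2 * length xs) \<and>
        tree_for G (2 ^ L) x f xs d)"
proof -
  define n where "n = length xs"
  let ?Q = "\<lambda>(R :: nat \<Rightarrow> 'a val, M :: nat \<Rightarrow> 'a val). \<exists>L f x. numbering xs f \<and> length xs \<le> 2 ^ L \<and> (L = 0 \<or> 2 ^ L < 2 * length xs) \<and>
        tree_for G (2 ^ L) x f xs (R 0)"
  have m: "0 < (2::nat) ^ (w - 1)" "(2::nat) ^ (w - 1) < 2 ^ w" using w by auto
  show ?thesis
    unfolding build_com_def
  proof (rule runs_in_run, rule runs_in_SeqI[OF run_prep[OF w]])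
    fix R M assume "\<exists>L f. prepared w xs L f (R :: nat \<Rightarrow> 'a val, M)"
    then obtain L f where prep: "prepared w xs L f (R, M)" by blast
    then have num: "numbering xs f" "length xs \<le> 2 ^ L" "L = 0 \<or> 2 ^ L < 2 * length xs"
      and R7: "R 7 = Scalar (Word (2 ^ (w - 1)))" by (auto simp: prepared_def)
    show "runs_in (exec w prim (Rand 8 7 ;; tree_com build) (R, M)) (cost_bound P (length xs) - (33 * real (length xs) + 20)) ?Q"
    proof (rule runs_in_SeqI[OF runs_in_Rand[OF _ m]])
      show "word_of (R 7) = 2 ^ (w - 1)" by (simp add: R7)
      fix R' M' assume "\<exists>x<2 ^ (w - 1). (R', M') = (R(8 := Scalar (Word x)), M)"
      then obtain x where x: "x < 2 ^ (w - 1)" and R': "R' = R(8 := Scalar (Word x))" "M' = M" by blast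
      have prep': "prepared w xs L f (R', M')" using prep by (simp add: prepared_def R')
      have R8: "R' 8 = Scalar (Word x)" by (simp add: R')
      let ?pts = "node_points (2 ^ L) x f xs"
      have "(\<Sum>v=1..<2 * 2 ^ L. P (length (?pts v)) + 6 * real (length (?pts v)) + 10)
        = (\<Sum>v=1..<2 * 2 ^ L. P (length (?pts v))) + 6 * real (\<Sum>v=1..<2 * 2 ^ L. length (?pts v)) + 10 * real (2 * 2 ^ L - 1)"
        by (simp add: sum.distrib sum_distrib_left)
      also have "\<dots> \<le> (2 * 2 ^ L * P 0 + (real L + 1) * P n) + 6 * ((real L + 1) * real n) + 10 * (2 * 2 ^ L)"
      proof (intro add_mono mult_left_mono)
        show "(\<Sum>v=1..<2 * 2 ^ L. P (length (?pts v))) \<le> 2 * 2 ^ L * P 0 + (real L + 1) * P n"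
          unfolding n_def by (rule sum_node_bound) (use P in auto)
        have "real (\<Sum>v=1..<2 * 2 ^ L. length (?pts v)) \<le> real ((L + 1) * length xs)"
          unfolding of_nat_le_iff by (rule sum_length_node_points)
        then show "real (\<Sum>v=1..<2 * 2 ^ L. length (?pts v)) \<le> (real L + 1) * real n" by (simp add: n_def algebra_simps)
        have "real (2 * 2 ^ L - 1) \<le> real (2 * 2 ^ L)" by (simp only: of_nat_le_iff)
        then show "real (2 * 2 ^ L - 1) \<le> 2 * 2 ^ L" by simp
      qed auto
      \<comment> \<open>This is the origin of the left side of \<open>cost_bound_ge\<close>: 33 + 24
        = 57 per point, 20 + 1 + 8 = 29 once, and 2 + 20 = 22 per leaf.\<close>
      finally have "33 * real n + 20 + 1 + ((13 * real L + 24) * real n + 2 * 2 ^ L + 8 +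
          (\<Sum>v=1..<2 * 2 ^ L. P (length (?pts v)) + 6 * real (length (?pts v)) + 10))
        \<le> 57 * real n + 29 + 13 * real L * real n + 22 * 2 ^ L + 2 * 2 ^ L * P 0 + (real L + 1) * P n + 6 * (real L + 1) * real n"
        by (simp add: algebra_simps)
      also have "\<dots> \<le> cost_bound P n"
        using P num by (intro cost_bound_ge) (auto simp: n_def)
      finally have le: "(13 * real L + 24) * real n + 2 * 2 ^ L + 8 +
          (\<Sum>v=1..<2 * 2 ^ L. P (length (?pts v)) + 6 * real (length (?pts v)) + 10)
          \<le> cost_bound P n - (33 * real n + 20) - 1" by simp
      show "runs_in (exec w prim (tree_com build) (R', M')) (cost_bound P (length xs) - (33 * real (length xs) + 20) - 1) ?Q"
        by (rule runs_in_weaken[OF run_tree[where P = P and G = G, OF w x prep' R8 build]])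
          (use le num in \<open>auto simp: n_def\<close>)
    qed
  qed
qed

text \<open>The state before \<open>Rand\<close> fixes \<open>L\<close> and \<open>f\<close>, so
  they cannot depend on the multiplier. Given these and \<open>x\<close>, \<open>g d\<close> is at
  most \<open>b L f x\<close> for every tree that the builders may produce; their randomness drops
  out and only the average over \<open>x\<close> remains.\<close>

lemma nn_integral_run_build:
  fixes xs :: "('a \<times> nat) list" and g :: "'a val \<Rightarrow> ennreal"
  assumes w: "2 \<le> w" "4 * length xs + 4 < 2 ^ w"
    and build: "\<And>Q. runs_in (run w prim build [Arr (map point_val (filter Q xs))])
      (P (length (filter Q xs))) (G (filter Q xs))"
    and b: "\<And>L f x. 0 \<le> b L f x"
    and g: "\<And>L f x d. numbering xs f \<Longrightarrow> length xs \<le> 2 ^ L \<Longrightarrow> L = 0 \<or> 2 ^ L < 2 * length xs \<Longrightarrow>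
      tree_for G (2 ^ L) x f xs d \<Longrightarrow> g d \<le> ennreal (b L f x)"
    and sum: "\<And>L f. numbering xs f \<Longrightarrow> length xs \<le> 2 ^ L \<Longrightarrow> L = 0 \<or> 2 ^ L < 2 * length xs \<Longrightarrow>
      (\<Sum>x<2 ^ (w - 1). b L f x) \<le> B * 2 ^ (w - 1)"
  shows "(\<integral>\<^sup>+ y. g (fst y) \<partial>measure_spmf (run w prim (build_com build) [Arr (map point_val xs)])) \<le> ennreal B"
proof -
  have m: "0 < (2::nat) ^ (w - 1)" "(2::nat) ^ (w - 1) < 2 ^ w" using w by auto
  define h :: "'a state \<Rightarrow> ennreal" where "h s = g (fst s 0)" for s
  let ?s = "(\<lambda>i. if i < length [Arr (map point_val xs)] then [Arr (map point_val xs)] ! i else zero_val, \<lambda>_. zero_val) :: 'a state"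
  have "(\<integral>\<^sup>+ y. g (fst y) \<partial>measure_spmf (run w prim (build_com build) [Arr (map point_val xs)])) =
    (\<integral>\<^sup>+ y. h (fst y) \<partial>measure_spmf (exec w prim (build_com build) ?s))"
    by (simp add: run_def init_state_def h_def o_def case_prod_unfold)
  also have "\<dots> = (\<integral>\<^sup>+ z. (\<integral>\<^sup>+ y. h (fst y) \<partial>measure_spmf (exec w prim (Rand 8 7 ;; tree_com build) (fst z)))
     \<partial>measure_spmf (exec w prim prep_com ?s))"
    unfolding build_com_def by (rule nn_integral_exec_Seq)
  also have "\<dots> \<le> ennreal B"
  proof (rule nn_integral_spmf_le)
    fix z assume "z \<in> set_spmf (exec w prim prep_com ?s)"
    then have "\<exists>L f. prepared w xs L f (fst z)" by (rule runs_in_set[OF run_prep[OF w]])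
    moreover obtain R M where z: "fst z = (R, M)" by (cases "fst z")
    ultimately obtain L f where prep: "prepared w xs L f (R, M)" by auto
    then have num: "numbering xs f" "length xs \<le> 2 ^ L" "L = 0 \<or> 2 ^ L < 2 * length xs"
      and R7: "R 7 = Scalar (Word (2 ^ (w - 1)))" by (auto simp: prepared_def)
    define H where "H s = (\<integral>\<^sup>+ y. h (fst y) \<partial>measure_spmf (exec w prim (tree_com build) s))" for s
    have H: "H (R(8 := Scalar (Word x)), M) \<le> ennreal (b L f x)" if x: "x < 2 ^ (w - 1)" for x
      unfolding H_def
    proof (rule nn_integral_spmf_le)
      let ?R = "R(8 := Scalar (Word x))"
      have prep': "prepared w xs L f (?R, M)" using prep by (simp add: prepared_def)
      have R8: "?R 8 = Scalar (Word x)" by simp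
      fix y assume "y \<in> set_spmf (exec w prim (tree_com build) (?R, M))"
      then have "tree_for G (2 ^ L) x f xs (fst (fst y) 0)"
        using runs_in_set[OF run_tree[where P = P and G = G, OF w x prep' R8 build]]
        by (simp only: case_prod_unfold)
      from g[OF num this] show "h (fst y) \<le> ennreal (b L f x)" by (simp add: h_def)
    qed
    have "(\<integral>\<^sup>+ y. h (fst y) \<partial>measure_spmf (exec w prim (Rand 8 7 ;; tree_com build) (fst z))) =
       (\<Sum>x<2 ^ (w - 1). H (R(8 := Scalar (Word x)), M)) / of_nat (2 ^ (w - 1))"
      unfolding nn_integral_exec_Seq z H_def[symmetric]
      by (rule nn_integral_exec_Rand[OF _ m]) (simp add: R7)
    also have "\<dots> \<le> (\<Sum>x<2 ^ (w - 1). ennreal (b L f x)) / of_nat (2 ^ (w - 1))"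
      using H by (intro divide_right_mono_ennreal sum_mono) simp
    also have "\<dots> = ennreal (\<Sum>x<2 ^ (w - 1). b L f x) / ennreal (2 ^ (w - 1))"
      using b by (simp add: ennreal_of_nat_eq_real_of_nat)
    also have "\<dots> = ennreal ((\<Sum>x<2 ^ (w - 1). b L f x) / 2 ^ (w - 1))"
      using b by (intro divide_ennreal sum_nonneg) auto
    also have "\<dots> \<le> ennreal B"
      using sum[OF num] by (intro ennreal_leI) (simp add: field_simps)
    finally show "(\<integral>\<^sup>+ y. h (fst y) \<partial>measure_spmf (exec w prim (Rand 8 7 ;; tree_com build) (fst z))) \<le> ennreal B" .
  qed
  finally show ?thesis .
qed

section \<open>From the tree to the reporting structure\<close>

lemma colors_in_node_points:
  "colors_in (set (node_points N x f xs v)) r =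
     colors_below (\<lambda>c. N + hash N x (f c)) (colors_in (set xs) r) v"
  by (auto simp: colors_in_def points_in_def node_points_def colors_below_def)

lemma vsize_pos: "1 \<le> vsize v"
  by (cases v) auto

text \<open>Space sums over the nodes exactly as preprocessing time does, with smaller overheads, so
  the same \<open>cost_bound\<close> serves for both.\<close>

lemma vsize_tree:
  assumes tree: "tree_for G (2 ^ L) x f xs d" and G: "\<And>ys d. G ys d \<Longrightarrow> real (vsize d) \<le> S (length ys)"
    and S: "mono_on {1..} (\<lambda>n. S n / real n)" "1 \<le> S 0" "1 \<le> S (length xs)" "real (length xs) \<le> S (length xs)"
    and L: "L = 0 \<or> 2 ^ L < 2 * length xs"
  shows "real (vsize d) \<le> cost_bound S (length xs)"
proof -
  obtain ds where d: "d = Arr ds" and ds: "length ds = 2 * 2 ^ L" "ds ! 0 = zero_val"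
    and nodes: "\<And>v. v \<in> {1..<2 * 2 ^ L} \<Longrightarrow> G (node_points (2 ^ L) x f xs v) (ds ! v)"
    using tree by (auto simp: tree_for_def)
  have "vsize d = 1 + (\<Sum>v=0..<2 * 2 ^ L. vsize (ds ! v))"
    by (simp add: d ds sum_list_sum_nth)
  also have "(\<Sum>v=0..<2 * 2 ^ L. vsize (ds ! v)) = vsize (ds ! 0) + (\<Sum>v=1..<2 * 2 ^ L. vsize (ds ! v))"
    by (simp add: sum.atLeast_Suc_lessThan)
  \<comment> \<open>One word for the array itself and one for slot 0.\<close>
  finally have "real (vsize d) = 2 + (\<Sum>v=1..<2 * 2 ^ L. real (vsize (ds ! v)))"
    by (simp add: ds)
  also have "\<dots> \<le> 2 + (\<Sum>v=1..<2 * 2 ^ L. S (length (node_points (2 ^ L) x f xs v)))"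
    using nodes G by (intro add_mono sum_mono) auto
  also have "\<dots> \<le> 2 + (2 * 2 ^ L * S 0 + (real L + 1) * S (length xs))"
    using S by (intro add_mono sum_node_bound) auto
  also have "\<dots> \<le> 57 * real (length xs) + 29 + 13 * real L * real (length xs) + 22 * 2 ^ L + 2 * 2 ^ L * S 0 +
     (real L + 1) * S (length xs) + 6 * (real L + 1) * real (length xs)"
    by simp
  also have "\<dots> \<le> cost_bound S (length xs)" using S L by (intro cost_bound_ge) auto
  finally show ?thesis .
qed

theorem theorem4:
  fixes U V :: "nat \<Rightarrow> 'a set"
    and rng :: "'a \<Rightarrow> 'a set"
    and prim :: "nat \<Rightarrow> 'o \<Rightarrow> 'a scalar list \<Rightarrow> 'a scalar"
    and P S Q0 Q1 :: "nat \<Rightarrow> real"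
  assumes "uniqueness_structure U V rng prim P S Q0 Q1"
    and "mono_on {1..} (\<lambda>n. P n / real n)"
    and "mono_on {1..} (\<lambda>n. S n / real n)"
    and "mono Q0" and "mono Q1"
  shows "\<exists>P' S' C. P' \<in> O(\<lambda>n. P n * log 2 (real n)) \<and> S' \<in> O(\<lambda>n. S n * log 2 (real n)) \<and>
           color_reporting_structure U V rng prim P' S'
             (\<lambda>n k. C * real (max 1 k) * (Q0 n + Q1 n))"
\<comment> \<open>Origin of 250: for \<open>T = Q0 n + Q1 n\<close>, which is at least 2,
  \<open>T + 29 \<le> 16 * T\<close>, and \<open>1 + 12 * k \<le> 13 * max 1 k\<close>, so the
  descent costs at most 208 times \<open>max 1 k * T\<close>. The remaining
  \<open>6 * k + 15\<close> is at most \<open>21 * max 1 k\<close>, hence at most 10.5 times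
  \<open>max 1 k * T\<close>.\<close>
proof (rule exI[of _ "cost_bound P"], rule exI[of _ "cost_bound S"], rule exI[of _ 250], intro conjI)
  show "cost_bound P \<in> O(\<lambda>n. P n * log 2 (real n))" "cost_bound S \<in> O(\<lambda>n. S n * log 2 (real n))"
    by (rule cost_bound_bigo)+
  obtain c build unique probe where build:
    "\<And>w xs. admissible U c w xs \<Longrightarrow> runs_in (run w prim build [Arr (map point_val xs)]) (P (length xs))
       (node_ok V rng prim unique probe S Q0 Q1 w xs)"
    using uniqueness_structureE[OF assms(1)] by metis
  \<comment> \<open>The exponent \<open>c + 4\<close> serves two ends: every sublist stays
    admissible for \<open>c\<close>, and \<open>4 * n + 16 \<le> (n + 2) ^ 4\<close> makes all heap
    indices fit into a word.\<close>
  have sub: "admissible U c w (filter Q xs) \<and> 2 \<le> w \<and> 4 * length xs + 4 < 2 ^ w"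
    if "admissible U (c + 4) w xs" for w Q and xs :: "('a \<times> nat) list"
  proof -
    define n where "n = length xs"
    have adm: "distinct xs" "set xs \<subseteq> U w \<times> {..<2 ^ w}" "(n + 2) ^ (c + 4) \<le> 2 ^ w"
      using that by (auto simp: admissible_def n_def)
    have "(length (filter Q xs) + 2) ^ c \<le> (n + 2) ^ c"
      by (intro power_mono) (auto simp: n_def)
    also have "\<dots> \<le> (n + 2) ^ (c + 4)" by (intro power_increasing) auto
    finally have "admissible U c w (filter Q xs)"
      using adm by (auto simp: admissible_def)
    moreover have "(n + 2) ^ 4 \<le> (2::nat) ^ w"
      using adm(3) power_increasing[of 4 "c + 4" "n + 2"] by linarith
    moreover have "4 * n + 16 \<le> (n + 2) ^ 4"
      by (simp add: power4_eq_xxxx algebra_simps)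
    ultimately show ?thesis
    proof (intro conjI)
      have "(2::nat) ^ 2 \<le> 2 ^ w" using \<open>(n + 2) ^ 4 \<le> (2::nat) ^ w\<close> \<open>4 * n + 16 \<le> (n + 2) ^ 4\<close> by simp
      then show "2 \<le> w" by (subst (asm) power_increasing_iff) auto
    qed (auto simp: n_def)
  qed
  define G where "G w = node_ok V rng prim unique probe S Q0 Q1 w" for w
  show "color_reporting_structure U V rng prim (cost_bound P) (cost_bound S)
     (\<lambda>n k. 250 * real (max 1 k) * (Q0 n + Q1 n))"
    unfolding color_reporting_structure_def
  proof (rule exI[of _ "c + 4"], rule exI[of _ "build_com build"], rule exI[of _ "report_com unique probe"],
      intro allI impI)
    fix w and xs :: "('a \<times> nat) list"
    assume adm: "admissible U (c + 4) w xs"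
    define n where "n = length xs"
    have w: "2 \<le> w" "4 * length xs + 4 < 2 ^ w" using sub[OF adm] by auto
    have bld: "runs_in (run w prim build [Arr (map point_val (filter Q xs))]) (P (length (filter Q xs))) (G w (filter Q xs))" for Q
      unfolding G_def using sub[OF adm] by (intro build) auto
    \<comment> \<open>Applied to the empty list, to a singleton and to all of \<open>xs\<close>,
      this bounds \<open>P\<close> and \<open>S\<close> from below at 0, 1 and
      \<open>n\<close>.\<close>
    have ge_1: "1 \<le> P (length (filter Q xs)) \<and> 1 \<le> S (length (filter Q xs))" for Q
    proof -
      obtain d where "G w (filter Q xs) d" using runs_in_nonempty[OF bld] by blast
      then have "real (vsize d) \<le> S (length (filter Q xs))" by (simp add: G_def node_ok_def)
      moreover have "1 \<le> real (vsize d)" using vsize_pos[of d] by simp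
      ultimately show ?thesis using runs_in_run_ge_1[OF bld] by simp
    qed
    have 0: "1 \<le> P 0" "1 \<le> S 0" using ge_1[of "\<lambda>_. False"] by auto
    have n1: "1 \<le> P n" "1 \<le> S n" using ge_1[of "\<lambda>_. True"] by (auto simp: n_def)
    \<comment> \<open>Monotonicity of \<open>P n / n\<close> and \<open>S n / n\<close> transports
      the lower bound 1 from a singleton to size \<open>n\<close>; linear overheads are thereby
      absorbed.\<close>
    have lin: "real n \<le> P n \<and> real n \<le> S n"
    proof (cases xs)
      case (Cons p ys)
      then have "filter (\<lambda>q. q = p) xs = [p]"
        using adm by (auto simp: admissible_def filter_empty_conv)
      then have "1 \<le> P 1" "1 \<le> S 1" using ge_1[of "\<lambda>q. q = p"] by auto
      moreover have "P 1 / real 1 \<le> P n / real n" "S 1 / real 1 \<le> S n / real n"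
        using Cons by (intro mono_onD[OF assms(2)] mono_onD[OF assms(3)]; simp add: n_def)+
      moreover have "0 < real n" using Cons by (simp add: n_def)
      ultimately have "1 \<le> P n / real n" "1 \<le> S n / real n"
        by (metis div_by_1 of_nat_1 order_trans)+
      with \<open>0 < real n\<close> show ?thesis by (simp add: le_divide_eq)
    qed (use n1 in \<open>simp add: n_def\<close>)
    let ?D = "run w prim (build_com build) [Arr (map point_val xs)]"
    let ?ok = "\<lambda>L f x d. numbering xs f \<and> length xs \<le> 2 ^ L \<and> (L = 0 \<or> 2 ^ L < 2 * length xs) \<and>
        tree_for (G w) (2 ^ L) x f xs d"
    have D: "runs_in ?D (cost_bound P n) (\<lambda>d. \<exists>L f x. ?ok L f x d)"
      unfolding n_def by (rule run_build[OF w bld assms(2)]) (use 0 n1 lin in \<open>auto simp: n_def\<close>)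
    have size: "real (vsize d) \<le> cost_bound S n" if "?ok L f x d" for L f x d
      unfolding n_def using that 0 n1 lin
      by (intro vsize_tree[where G = "G w" and L = L and x = x and f = f] assms(3)) (auto simp: n_def G_def node_ok_def)
    define K where "K q = colors_in (set xs) (rng q)" for q
    define b where "b q L f x = (Q0 n + Q1 n + 29) *
       (1 + 2 * real (card (branching (2 ^ L) (\<lambda>c. 2 ^ L + hash (2 ^ L) x (f c)) (K q) 1))) + 6 * real (card (K q)) + 15"
      for q L f x
    \<comment> \<open>Both claims share their assumptions: a lower bound on \<open>Q0 n\<close> and
      \<open>Q1 n\<close> needs an actual query run on an actual tree, and \<open>V w\<close> may be
      empty.\<close>
    have report: "runs_in (run w prim (report_com unique probe) [d, Scalar (Atom q)]) (b q L f x)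
        (\<lambda>v. \<exists>cs. v = Arr (map (\<lambda>a. Scalar (Word a)) cs) \<and> distinct cs \<and> set cs = K q)"
      and Q_pos: "1 \<le> Q0 n \<and> 1 \<le> Q1 n"
      if "?ok L f x d" and q: "q \<in> V w" for L f x d q
    proof -
      have L: "length xs \<le> 2 ^ L" "L = 0 \<or> 2 ^ L < 2 * length xs" and num: "numbering xs f"
        and "tree_for (G w) (2 ^ L) x f xs d" using that by auto
      then obtain ds where d: "d = Arr ds" and ds: "length ds = 2 * 2 ^ L"
        and nodes: "\<And>v. v \<in> {1..<2 * 2 ^ L} \<Longrightarrow> G w (node_points (2 ^ L) x f xs v) (ds ! v)"
        by (auto simp: tree_for_def)
      have N: "2 * 2 ^ L < (2::nat) ^ w" using L(2) w by auto
      have finK: "finite (K q)" by (auto simp: K_def colors_in_def points_in_def)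
      have "card (K q) \<le> card (snd ` set xs)"
        by (intro card_mono) (auto simp: K_def colors_in_def points_in_def)
      also have "\<dots> \<le> length xs" using card_image_le[of "set xs" snd] card_length[of xs] by simp
      finally have cardK: "card (K q) < 2 ^ w" using w by simp
      have K_sub: "K q \<subseteq> snd ` set xs" by (auto simp: K_def colors_in_def points_in_def)
      let ?leaf = "\<lambda>c. 2 ^ L + hash (2 ^ L) x (f c)"
      have f: "inj_on f (K q)" "f ` K q \<subseteq> {1..2 ^ L}"
        using num L(1) K_sub by (auto simp: numbering_def intro: inj_on_subset) (force dest: subsetD)+
      have inj: "inj_on ?leaf (K q)"
        using f inj_on_hash[of L x] by (auto simp: inj_on_def image_subset_iff)
      have leaf: "2 ^ L \<le> ?leaf c \<and> ?leaf c < 2 * 2 ^ L" for c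
        using hash_less[of "2 ^ L" x "f c"] by simp
      have len: "length (node_points (2 ^ L) x f xs v) \<le> n" for v by (simp add: node_points_def n_def)
      have below: "colors_in (set (node_points (2 ^ L) x f xs v)) (rng q) = colors_below ?leaf (K q) v" for v
        by (simp add: colors_in_node_points K_def)
      have probe: "runs_in (run w prim probe [ds ! v, Scalar (Atom q)]) (Q0 n)
          (\<lambda>e. if colors_below ?leaf (K q) v = {} then e = zero_val
             else \<exists>a. \<exists>c\<in>colors_below ?leaf (K q) v. e = Arr [a, Scalar (Word c)])"
        and unique: "runs_in (run w prim unique [ds ! v, Scalar (Atom q)]) (Q1 n)
          (\<lambda>u. u = bool_val (card (colors_below ?leaf (K q) v) = 1))" if "1 \<le> v" "v < 2 * 2 ^ L" for v
      proof -
        let ?pts = "node_points (2 ^ L) x f xs v"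
        have "G w ?pts (ds ! v)" using nodes that by simp
        then have *: "runs_in (run w prim unique [ds ! v, Scalar (Atom q)]) (Q1 (length ?pts))
            (\<lambda>v. v = bool_val (card (colors_in (set ?pts) (rng q)) = 1))"
          "runs_in (run w prim probe [ds ! v, Scalar (Atom q)]) (Q0 (length ?pts))
            (\<lambda>v. if colors_in (set ?pts) (rng q) = {} then v = zero_val
               else \<exists>a. \<exists>c\<in>colors_in (set ?pts) (rng q). v = Arr [a, Scalar (Word c)])"
          using q unfolding G_def node_ok_def by blast+
        show "runs_in (run w prim probe [ds ! v, Scalar (Atom q)]) (Q0 n)
          (\<lambda>e. if colors_below ?leaf (K q) v = {} then e = zero_val
             else \<exists>a. \<exists>c\<in>colors_below ?leaf (K q) v. e = Arr [a, Scalar (Word c)])"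
          by (rule runs_in_weaken[OF *(2)[unfolded below] monoD[OF assms(4) len]])
        show "runs_in (run w prim unique [ds ! v, Scalar (Atom q)]) (Q1 n)
          (\<lambda>u. u = bool_val (card (colors_below ?leaf (K q) v) = 1))"
          by (rule runs_in_weaken[OF *(1)[unfolded below] monoD[OF assms(5) len]])
      qed
      show "runs_in (run w prim (report_com unique probe) [d, Scalar (Atom q)]) (b q L f x)
        (\<lambda>v. \<exists>cs. v = Arr (map (\<lambda>a. Scalar (Word a)) cs) \<and> distinct cs \<and> set cs = K q)"
        unfolding d b_def using leaf probe unique
        by (intro run_report[OF w(1) N _ ds finK cardK inj]) auto
      have "(1::nat) \<le> 2 ^ L" by simp
      then have "(1::nat) < 2 * 2 ^ L" by linarith
      then show "1 \<le> Q0 n \<and> 1 \<le> Q1 n"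
        using runs_in_run_ge_1[OF probe[of 1]] runs_in_run_ge_1[OF unique[of 1]] by simp
    qed
    have ret: "\<exists>L f x. ?ok L f x d" if "(d, t) \<in> set_spmf ?D" for d t
      using D that by (auto simp: runs_in_iff)
    have time: "expected_time (bind_spmf ?D (\<lambda>(d, t). run w prim (report_com unique probe) [d, Scalar (Atom q)]))
        \<le> ennreal (250 * real (max 1 (card (K q))) * (Q0 n + Q1 n))" if q: "q \<in> V w" for q
    proof -
      let ?k = "card (K q)" and ?T = "Q0 n + Q1 n"
      obtain d0 t0 where "(d0, t0) \<in> set_spmf ?D" using runs_in_nonempty[OF D] by blast
      then have T: "2 \<le> ?T" using ret Q_pos q by fastforce
      have "expected_time (bind_spmf ?D (\<lambda>(d, t). run w prim (report_com unique probe) [d, Scalar (Atom q)]))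
        = (\<integral>\<^sup>+ y. expected_time (run w prim (report_com unique probe) [fst y, Scalar (Atom q)]) \<partial>measure_spmf ?D)"
        using runs_in_lossless[OF D] ret report[OF _ q] by (intro expected_time_bind) (blast dest: runs_in_lossless)+
      also have "\<dots> \<le> ennreal ((?T + 29) * (1 + 12 * real ?k) + 6 * real ?k + 15)"
      proof (rule nn_integral_run_build[OF w bld, where b = "b q" and g = "\<lambda>d. expected_time (run w prim (report_com unique probe) [d, Scalar (Atom q)])"])
        show "0 \<le> b q L f x" for L f x using T by (simp add: b_def)
        show "expected_time (run w prim (report_com unique probe) [d, Scalar (Atom q)]) \<le> ennreal (b q L f x)"
          if "numbering xs f" "length xs \<le> 2 ^ L" "L = 0 \<or> 2 ^ L < 2 * length xs" "tree_for (G w) (2 ^ L) x f xs d" for L f x d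
          using report[of f L x d q] that q by (auto simp: runs_in_def)
        fix L f
        assume num: "numbering xs f" and L: "length xs \<le> 2 ^ L" "L = 0 \<or> 2 ^ L < 2 * length xs"
        have "(2::nat) ^ L \<le> 2 * length xs + 1" using L(2) by auto
        then have "(2::nat) ^ L < 2 ^ w" using w(2) by linarith
        \<comment> \<open>The side condition of \<open>sum_branching\<close> for
          \<open>m = w - 1\<close>: the odd multiplier has \<open>w\<close> bits, of which at least
          \<open>L\<close> must be random or fixed to 1.\<close>
        then have "L \<le> w - 1 + 1" by simp
        moreover have "finite (K q)" "K q \<subseteq> snd ` set xs" by (auto simp: K_def colors_in_def points_in_def)
        moreover from this have "inj_on f (K q)" "f ` K q \<subseteq> {1..2 ^ L}"
          using num L(1) by (auto simp: numbering_def intro: inj_on_subset) (force dest: subsetD)+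
        ultimately have br: "(\<Sum>x<2 ^ (w - 1). real (card (branching (2 ^ L) (\<lambda>c. 2 ^ L + hash (2 ^ L) x (f c)) (K q) 1)))
           \<le> 6 * real ?k * 2 ^ (w - 1)" by (intro sum_branching)
        have "(\<Sum>x<2 ^ (w - 1). b q L f x) = (?T + 29) * (2 ^ (w - 1) +
           2 * (\<Sum>x<2 ^ (w - 1). real (card (branching (2 ^ L) (\<lambda>c. 2 ^ L + hash (2 ^ L) x (f c)) (K q) 1)))) +
           (6 * real ?k + 15) * 2 ^ (w - 1)"
          by (simp add: b_def sum.distrib sum_distrib_left algebra_simps)
        also have "\<dots> \<le> (?T + 29) * (2 ^ (w - 1) + 2 * (6 * real ?k * 2 ^ (w - 1))) + (6 * real ?k + 15) * 2 ^ (w - 1)"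
          using br T by (intro add_right_mono mult_left_mono add_left_mono) auto
        also have "\<dots> = ((?T + 29) * (1 + 12 * real ?k) + 6 * real ?k + 15) * 2 ^ (w - 1)"
          by (simp add: algebra_simps)
        finally show "(\<Sum>x<2 ^ (w - 1). b q L f x) \<le> ((?T + 29) * (1 + 12 * real ?k) + 6 * real ?k + 15) * 2 ^ (w - 1)" .
      qed
      also have "\<dots> \<le> ennreal (250 * real (max 1 ?k) * ?T)"
      proof (intro ennreal_leI)
        let ?m = "real (max 1 ?k)"
        have m: "1 \<le> ?m" "real ?k \<le> ?m" by auto
        have "(?T + 29) * (1 + 12 * real ?k) \<le> (16 * ?T) * (13 * ?m)"
          using T m by (intro mult_mono) auto
        also have "\<dots> = 208 * (?m * ?T)" by (simp add: algebra_simps)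
        finally have A: "(?T + 29) * (1 + 12 * real ?k) \<le> 208 * (?m * ?T)" .
        have B: "2 * ?m \<le> ?m * ?T" using T mult_left_mono[of 2 ?T ?m] by (simp add: mult.commute)
        have "a + 6 * k + 15 \<le> 250 * y" if "a \<le> 208 * y" "2 * m \<le> y" "1 \<le> m" "k \<le> m" for a k m y :: real
          using that by argo
        from this[OF A B m] show "(?T + 29) * (1 + 12 * real ?k) + 6 * real ?k + 15 \<le> 250 * ?m * ?T"
          by (simp only: mult.assoc)
      qed
      finally show ?thesis .
    qed
    show "let n = length xs; X = set xs; D = ?D in
             expected_time D \<le> ennreal (cost_bound P n) \<and>
             returns D (\<lambda>d. real (vsize d) \<le> cost_bound S n \<and>
               (\<forall>q \<in> V w. returns (run w prim (report_com unique probe) [d, Scalar (Atom q)])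
                  (\<lambda>v. \<exists>cs. v = Arr (map (\<lambda>a. Scalar (Word a)) cs) \<and> distinct cs \<and>
                          set cs = colors_in X (rng q)))) \<and>
             (\<forall>q \<in> V w.
                expected_time (bind_spmf D (\<lambda>(d, t). run w prim (report_com unique probe) [d, Scalar (Atom q)]))
                  \<le> ennreal (250 * real (max 1 (card (colors_in X (rng q)))) * (Q0 n + Q1 n)))"
      unfolding Let_def n_def[symmetric] K_def[symmetric]
    proof (intro conjI ballI)
      show "expected_time ?D \<le> ennreal (cost_bound P n)" using D by (simp add: runs_in_def)
      show "returns ?D (\<lambda>d. real (vsize d) \<le> cost_bound S n \<and>
               (\<forall>q \<in> V w. returns (run w prim (report_com unique probe) [d, Scalar (Atom q)])
                  (\<lambda>v. \<exists>cs. v = Arr (map (\<lambda>a. Scalar (Word a)) cs) \<and> distinct cs \<and> set cs = K q)))"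
        unfolding returns_def[of ?D]
      proof safe
        fix d t assume "(d, t) \<in> set_spmf ?D"
        then obtain L f x where ok: "?ok L f x d" using ret by blast
        show "real (vsize d) \<le> cost_bound S n" by (rule size[OF ok])
        fix q assume "q \<in> V w"
        then show "returns (run w prim (report_com unique probe) [d, Scalar (Atom q)])
                  (\<lambda>v. \<exists>cs. v = Arr (map (\<lambda>a. Scalar (Word a)) cs) \<and> distinct cs \<and> set cs = K q)"
          using report[OF ok] by (simp add: runs_in_def)
      qed
    qed (rule time)
  qed
qed

end
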